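(* Let $c>0$ and $\Delta=(0,c]$. Let $G$ be a probability distribution on $\mathbb R$, let $\lambda>0$, and let $\mu$ be the compound Poisson distribution $$\mu(dx)=e^{-\lambda}\sum_{n=0}^\infty \frac{\lambda^n}{n!}\,G^{*n}(dx),$$ where $G^{*0}$ is the Dirac measure at $0$. Then the following are equivalent: (i) $\mu\in\mathcal S_\Delta\cap\mathcal D_\Delta$; (ii) $G\in\mathcal S_\Delta\cap\mathcal D_\Delta$; (iii) $G\in\mathcal L_\Delta\cap\mathcal D_\Delta$ and $\lim_{x\to\infty}\mu(x+\Delta)/G(x+\Delta)=\lambda$. If additionally $G$ is a distribution on $\mathbb R_+=[0,\infty)$, then the following are equivalent: (i) $\mu\in\mathcal S_\Delta$; (ii) $G\in\mathcal S_\Delta$; (iii) $G\in\mathcal L_\Delta$ and $\lim_{x\to\infty}\mu(x+\Delta)/G(x+\Delta)=\lambda$.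
   Context: For $\Delta=(0,c]$ and a distribution $F$ on $\mathbb R$, $F(x+\Delta):=F((x,x+c])$. $F^{*n}$ is the $n$-fold convolution of $F$ with itself. $\alpha(x)\sim\beta(x)$ means $\alpha(x)/\beta(x)\to1$ as $x\to\infty$. A non-negative measurable function $\alpha$ belongs to $\mathcal L$ if there is $x_0>0$ with $\alpha(x)>0$ for $x\ge x_0$ and, for every fixed $y>0$, $\alpha(x+y)\sim\alpha(x)$. $F\in\mathcal L_\Delta$ if the function $x\mapsto F(x+\Delta)$ is in $\mathcal L$. $F\in\mathcal S_\Delta$ if $F\in\mathcal L_\Delta$ and $F^{*2}(x+\Delta)\sim 2F(x+\Delta)$. A function $\alpha:\mathbb R\to\mathbb R_+$ is almost decreasing if there exist $x_0>0$ and $K>0$ such that $\alpha(x+y)\le K\alpha(x)$ for all $x>x_0$, $y>0$. $F\in\mathcal D_\Delta$ if $x\mapsto F(x+\Delta)$ is almost decreasing. *)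

theory Defs
  imports "HOL-Probability.Probability" "HOL-Library.Landau_Symbols"
begin

text \<open>A distribution on the real line is a measure \<open>F\<close> with \<^term>\<open>real_distribution F\<close>,
  i.e. a probability measure on the Borel sets.\<close>

fun conv_power :: "real measure \<Rightarrow> nat \<Rightarrow> real measure" where
  "conv_power F 0 = return borel 0"
| "conv_power F (Suc n) = convolution F (conv_power F n)"

definition compound_poisson :: "real \<Rightarrow> real measure \<Rightarrow> real measure" where
  "compound_poisson l G = measure_of UNIV (sets borel)
     (\<lambda>A. ennreal (exp (- l)) * (\<Sum>n. ennreal (l ^ n / fact n) * emeasure (conv_power G n) A))"

text \<open>\<open>F(x + \<Delta>)\<close> for \<open>\<Delta> = (0, c]\<close>.\<close>

definition local_prob :: "real \<Rightarrow> real measure \<Rightarrow> real \<Rightarrow> real" where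
  "local_prob c F x = measure F {x<..x + c}"

text \<open>The relation \<^const>\<open>asymp_equiv\<close> only differs from convergence of the quotient to 1 where both
  sides vanish; eventual positivity excludes this here and in the class \<open>S_Delta\<close> below.\<close>

definition long_tailed :: "(real \<Rightarrow> real) \<Rightarrow> bool" where
  "long_tailed a \<longleftrightarrow>
     a \<in> borel_measurable borel \<and> (\<forall>x. 0 \<le> a x) \<and>
     (\<exists>x0>0. \<forall>x\<ge>x0. 0 < a x) \<and>
     (\<forall>y>0. (\<lambda>x. a (x + y)) \<sim>[at_top] a)"

definition almost_decreasing :: "(real \<Rightarrow> real) \<Rightarrow> bool" where
  "almost_decreasing a \<longleftrightarrow>
     (\<forall>x. 0 \<le> a x) \<and> (\<exists>x0>0. \<exists>K>0. \<forall>x>x0. \<forall>y>0. a (x + y) \<le> K * a x)"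

definition L_Delta :: "real \<Rightarrow> real measure set" where
  "L_Delta c = {F. real_distribution F \<and> long_tailed (local_prob c F)}"

definition S_Delta :: "real \<Rightarrow> real measure set" where
  "S_Delta c = {F \<in> L_Delta c. local_prob c (conv_power F 2) \<sim>[at_top] (\<lambda>x. 2 * local_prob c F x)}"

definition D_Delta :: "real \<Rightarrow> real measure set" where
  "D_Delta c = {F. real_distribution F \<and> almost_decreasing (local_prob c F)}"

lemma sets_conv_power [simp]: "sets (conv_power F n) = sets borel"
  by (cases n) simp_all

lemma space_conv_power [simp]: "space (conv_power F n) = UNIV"
  by (cases n) simp_all

lemma sets_compound_poisson [simp]: "sets (compound_poisson l G) = sets borel"
  unfolding compound_poisson_def
  by (metis sets.sets_measure_of_eq space_borel)

lemma space_compound_poisson [simp]: "space (compound_poisson l G) = UNIV"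
  unfolding compound_poisson_def by (simp add: space_measure_of_conv)

text \<open>The set function passed to \<^const>\<open>measure_of\<close> is countably additive, so it is not
  replaced by the zero measure.\<close>

lemma emeasure_compound_poisson:
  assumes "A \<in> sets borel"
  shows "emeasure (compound_poisson l G) A =
    ennreal (exp (- l)) * (\<Sum>n. ennreal (l ^ n / fact n) * emeasure (conv_power G n) A)"
proof (rule emeasure_measure_of[OF compound_poisson_def])
  let ?mu = "\<lambda>A. ennreal (exp (- l)) * (\<Sum>n. ennreal (l ^ n / fact n) * emeasure (conv_power G n) A)"
  show "countably_additive (sets (compound_poisson l G)) ?mu"
  proof (rule countably_additiveI)
    fix B :: "nat \<Rightarrow> real set"
    assume B: "range B \<subseteq> sets (compound_poisson l G)" "disjoint_family B"
    have *: "(\<Sum>i. emeasure (conv_power G n) (B i)) = emeasure (conv_power G n) (\<Union>i. B i)" for n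
      using B by (intro suminf_emeasure) auto
    have "(\<Sum>i. \<Sum>n. ennreal (l ^ n / fact n) * emeasure (conv_power G n) (B i)) =
          (\<Sum>n. \<Sum>i. ennreal (l ^ n / fact n) * emeasure (conv_power G n) (B i))"
      using nn_integral_suminf[of "\<lambda>n i. ennreal (l ^ n / fact n) * emeasure (conv_power G n) (B i)"
          "count_space UNIV"]
      by (simp add: nn_integral_count_space_nat)
    then show "(\<Sum>i. ?mu (B i)) = ?mu (\<Union>i. B i)"
      by (simp add: *)
  qed
qed (use assms in \<open>auto simp: positive_def\<close>)

end

theory Submission
  imports Defs
begin

text \<open>Fix a reference distribution \<open>F\<close> in \<open>S_Delta\<close>, put \<open>\<tau> x = F (x + \<Delta>)\<close>, and say that a distribution \<open>M\<close> has
the local ratio \<open>r\<close> if \<open>r\<close> is bounded and measurable and \<open>M (x + \<Delta>) / \<tau> x - r x \<rightarrow> 0\<close> as \<open>x \<rightarrow> \<infinity>\<close>.  A sum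
of two independent variables is large because one of them is: if \<open>M\<close> and \<open>N\<close> have the local ratios
\<open>r\<close> and \<open>s\<close>, then \<open>M * N\<close> has the local ratio \<open>r * N + s * M\<close> (lemma \<open>local_asymp_convolution\<close>).  Indeed the
event that both summands exceed \<open>a\<close> is at most a constant times as likely as the same event for two
copies of \<open>F\<close> with threshold \<open>a - c\<close>, and the latter becomes negligible for large \<open>a\<close> by the definition of \<open>S_Delta\<close>.  So the local ratio is
a derivation with respect to convolution, and \<open>G\<^sup>*\<^sup>n\<close> has the local ratio \<open>n (r * G\<^sup>*\<^sup>n\<^sup>-\<^sup>1)\<close>.  A bound
\<open>G\<^sup>*\<^sup>n (x + \<Delta>) \<le> K\<^sup>n \<tau> x\<close> with \<open>K\<close> and the range of \<open>x\<close> independent of \<open>n\<close> (lemma \<open>conv_power_bound\<close>)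
allows summation against the Poisson weights, so that \<open>\<mu>\<close> has the local ratio \<open>\<lambda> (r * \<mu>)\<close>
(lemma \<open>compound_poisson_ratio_smoothed\<close>).

From \<open>G\<close> to \<open>\<mu>\<close> and to the limit of the ratio: take \<open>F = G\<close> and \<open>r = 1\<close>.
Then \<open>\<mu> (x + \<Delta>) / G (x + \<Delta>) \<rightarrow> \<lambda>\<close>, so \<open>\<mu> * \<mu>\<close> has the local ratio \<open>2 \<lambda>\<close>, and \<open>\<mu>\<close> inherits \<open>S_Delta\<close> and \<open>D_Delta\<close>.

From \<open>\<mu>\<close> to \<open>G\<close>: take \<open>F = \<mu>\<close> and \<open>r = G (x + \<Delta>) / \<mu> (x + \<Delta>)\<close>, which is bounded because \<open>\<mu>\<close> is at least
\<open>\<lambda> exp (-\<lambda>) G\<close>.  As \<open>\<mu>\<close> has the local ratio \<open>1\<close> with respect to itself, \<open>\<lambda> (r * \<mu>) \<rightarrow> 1\<close>.  Convolution with \<open>\<mu>\<close> is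
the operator \<open>exp (\<lambda> (T - 1))\<close>, where \<open>T\<close> is convolution with \<open>G\<close>; it is undone by \<open>exp (-\<lambda> (T - 1))\<close>, again a
convolution with a finite signed measure, which preserves limits at infinity.  Hence \<open>r \<rightarrow> 1 / \<lambda>\<close>
(lemmas \<open>deconvolution_tendsto\<close> and \<open>jump_distribution_ratio\<close>).

From the limit of the ratio to \<open>G\<close>: for a long-tailed \<open>G\<close>, the lower limit of \<open>G\<^sup>*\<^sup>n (x + \<Delta>) / G (x + \<Delta>)\<close> is at least \<open>n\<close>.  The
Poisson-weighted sum of these lower bounds is \<open>\<lambda>\<close>, which by assumption is also the limit of the weighted sum
of the ratios.  So no ratio can stay above its lower bound, and \<open>n = 2\<close> gives the claim
(lemma \<open>S_Delta_of_compound_poisson_ratio\<close>).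

Throughout, the Poisson parameter \<open>\<lambda>\<close> is the variable \<open>l\<close>.  The conditions "almost decreasing" and
"on the half-line" enter in the same way: a summand \<open>v \<le> a\<close> of
large modulus has to be negative, and \<open>\<tau> (x - v)\<close> must still be at most a constant times \<open>\<tau> x\<close>, or no
such \<open>v\<close> may occur.  Both cases are treated at once by the predicate \<open>admissible\<close>.\<close>

section \<open>Convolution of distributions on the line\<close>

lemma real_distribution_return: "real_distribution (return borel (0::real))"
  unfolding real_distribution_def real_distribution_axioms_def
  by (auto intro!: prob_space_return)

lemma real_distribution_convolution:
  assumes "real_distribution M" "real_distribution N"
  shows "real_distribution (M \<star> N)"
proof -
  interpret M: real_distribution M by fact
  interpret N: real_distribution N by fact
  interpret P: pair_prob_space M N ..
  have "prob_space (M \<star> N)"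
    unfolding convolution_def by (rule P.prob_space_distr) simp
  then show ?thesis
    by (simp add: real_distribution_def real_distribution_axioms_def)
qed

lemma real_distribution_conv_power:
  assumes "real_distribution G"
  shows "real_distribution (conv_power G n)"
  by (induction n) (auto intro: real_distribution_return real_distribution_convolution assms)

lemma integral_convolution:
  fixes f :: "real \<Rightarrow> real"
  assumes "real_distribution M" "real_distribution N"
    and f: "f \<in> borel_measurable borel" "\<And>x. \<bar>f x\<bar> \<le> B"
  shows "(\<integral>x. f x \<partial>(M \<star> N)) = (\<integral>u. (\<integral>v. f (u + v) \<partial>N) \<partial>M)"
proof -
  interpret M: real_distribution M by fact
  interpret N: real_distribution N by fact
  interpret P: pair_prob_space M N ..
  note [measurable] = f(1)
  have "integrable (M \<Otimes>\<^sub>M N) (\<lambda>(u, v). f (u + v))"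
    by (rule P.integrable_const_bound[where B=B]) (use f in auto)
  from P.integral_fst'[OF this]
  show ?thesis
    unfolding convolution_def by (subst integral_distr) (auto simp: case_prod_beta')
qed

lemma convolution_return:
  assumes "real_distribution G"
  shows "(G \<star> return borel 0) = G"
proof (rule measure_eqI)
  interpret G: real_distribution G by fact
  interpret D: real_distribution "return borel (0::real)" by (rule real_distribution_return)
  fix A assume "A \<in> sets (G \<star> return borel 0)"
  then have A: "A \<in> sets borel" by simp
  have "emeasure (G \<star> return borel 0) A = (\<integral>\<^sup>+x. indicator A x \<partial>G)"
    using A by (subst convolution_emeasure') (auto intro!: nn_integral_cong simp: nn_integral_return
       borel_measurable_indicator' G.finite_measure_axioms D.finite_measure_axioms)
  then show "emeasure (G \<star> return borel 0) A = emeasure G A"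
    using A by simp
qed (simp add: real_distribution.events_eq_borel[OF assms])

lemma conv_power_1: "real_distribution G \<Longrightarrow> conv_power G 1 = G"
  by (simp add: convolution_return)

lemma conv_power_2: "real_distribution G \<Longrightarrow> conv_power G 2 = (G \<star> G)"
  by (simp add: numeral_2_eq_2 convolution_return)

lemma AE_nonneg_convolution:
  fixes M N :: "real measure"
  assumes "real_distribution M" "real_distribution N" "AE u in M. 0 \<le> u" "AE v in N. 0 \<le> v"
  shows "AE w in M \<star> N. 0 \<le> w"
proof -
  interpret M: real_distribution M by fact
  interpret N: real_distribution N by fact
  interpret P: pair_prob_space M N ..
  have "{p \<in> space (M \<Otimes>\<^sub>M N). 0 \<le> fst p + snd p} \<in> sets (M \<Otimes>\<^sub>M N)"
    by measurable
  then have "AE p in M \<Otimes>\<^sub>M N. 0 \<le> fst p + snd p"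
    by (rule P.AE_pair_measure) (use assms(3,4) in \<open>auto elim!: eventually_mono\<close>)
  then show ?thesis
    unfolding convolution_def
    by (subst AE_distr_iff) (auto simp: case_prod_beta)
qed

lemma AE_nonneg_conv_power:
  assumes "real_distribution G" "AE u in G. 0 \<le> u"
  shows "AE w in conv_power G n. 0 \<le> w"
proof (induction n)
  case 0
  show ?case unfolding conv_power.simps by (subst AE_return) auto
next
  case (Suc n)
  then show ?case
    unfolding conv_power.simps
    by (intro AE_nonneg_convolution assms real_distribution_conv_power)
qed

lemma borel_measurable_local_prob [measurable]:
  assumes "real_distribution F" "c > 0"
  shows "local_prob c F \<in> borel_measurable borel"
proof -
  interpret real_distribution F by fact
  have "mono (cdf F)"
    by (simp add: cdf_nondecreasing mono_def)
  then have [measurable]: "cdf F \<in> borel_measurable borel"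
    by (rule borel_measurable_mono)
  have "local_prob c F = (\<lambda>x. cdf F (x + c) - cdf F x)"
    using \<open>c > 0\<close> by (simp add: local_prob_def fun_eq_iff cdf_diff_eq)
  then show ?thesis by simp
qed

lemma local_prob_nonneg: "0 \<le> local_prob c F x"
  by (simp add: local_prob_def)

lemma local_prob_le_1: "real_distribution F \<Longrightarrow> local_prob c F x \<le> 1"
  unfolding local_prob_def real_distribution_def by (simp add: prob_space.prob_le_1)

lemma half_line_AE:
  assumes "real_distribution G" "measure G {0..} = 1"
  shows "AE v in G. 0 \<le> v"
proof -
  interpret G: real_distribution G by fact
  have "AE v in G. v \<in> {0..}"
    using assms(2) by (subst (asm) G.prob_eq_1) auto
  then show ?thesis by simp
qed

lemma measure_atMost_tendsto:
  assumes "real_distribution N"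
  shows "((\<lambda>a. measure N {..a}) \<longlongrightarrow> 1) at_top"
  using real_distribution.cdf_lim_at_top_prob[OF assms] by (simp add: cdf_def)

lemma abs_integral_le:
  fixes f :: "real \<Rightarrow> real"
  assumes N: "real_distribution N" and f: "f \<in> borel_measurable borel" "\<And>v. \<bar>f v\<bar> \<le> B"
  shows "\<bar>\<integral>v. f v \<partial>N\<bar> \<le> B"
proof -
  interpret N: real_distribution N by fact
  have "integrable N f"
    by (rule N.integrable_const_bound[where B=B]) (use f in auto)
  then show ?thesis
    using f(2) by (intro order_trans[OF integral_abs_bound] N.integral_le_const) auto
qed

lemma integral_truncation_error:
  fixes r :: "real \<Rightarrow> real"
  assumes N: "real_distribution N" and r [measurable]: "r \<in> borel_measurable borel"
    and B: "\<And>x. \<bar>r x\<bar> \<le> B"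
  shows "\<bar>(\<integral>v. r (x - v) \<partial>N) - (\<integral>v. indicator {..a} v * r (x - v) \<partial>N)\<bar>
      \<le> B * (1 - measure N {..a})"
proof -
  interpret N: real_distribution N by fact
  have B0: "B \<ge> 0" using B[of 0] by linarith
  have 1: "integrable N (\<lambda>v. r (x - v))"
    by (rule N.integrable_const_bound[where B=B]) (use B in auto)
  have 2: "integrable N (\<lambda>v. indicator {..a} v * r (x - v))"
    by (rule N.integrable_const_bound[where B=B]) (use B B0 in \<open>auto simp: indicator_def\<close>)
  have "\<bar>(\<integral>v. r (x - v) \<partial>N) - (\<integral>v. indicator {..a} v * r (x - v) \<partial>N)\<bar>
      = \<bar>\<integral>v. r (x - v) - indicator {..a} v * r (x - v) \<partial>N\<bar>"
    using 1 2 by simp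
  also have "\<dots> \<le> (\<integral>v. \<bar>r (x - v) - indicator {..a} v * r (x - v)\<bar> \<partial>N)"
    by (rule integral_abs_bound)
  also have "\<dots> \<le> (\<integral>v. B * indicator {a<..} v \<partial>N)"
  proof (rule integral_mono)
    show "integrable N (\<lambda>v. \<bar>r (x - v) - indicator {..a} v * r (x - v)\<bar>)"
      using 1 2 by simp
    show "integrable N (\<lambda>v. B * indicator {a<..} v)"
      by (rule N.integrable_const_bound[where B=B]) (use B0 in \<open>auto simp: indicator_def\<close>)
  qed (use B in \<open>auto simp: indicator_def\<close>)
  also have "\<dots> = B * measure N {a<..}" by simp
  also have "measure N {a<..} = 1 - measure N {..a}"
  proof -
    have "{a<..} = space N - {..a}" by auto
    then show ?thesis by (simp only: N.prob_compl[of "{..a}"] N.sets_M borel_closed closed_atMost) 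
  qed
  finally show ?thesis .
qed

lemma filterlim_add_const_at_top: "filterlim (\<lambda>x. x + y) at_top (at_top :: real filter)"
  using filterlim_tendsto_add_at_top[OF tendsto_const[of y] filterlim_ident]
  by (simp add: add.commute)

section \<open>Splitting a convolution by the size of the summands\<close>

lemma joint_event_sets [simp, measurable]:
  fixes A B :: "real set"
  assumes [measurable]: "A \<in> sets borel" "B \<in> sets borel"
  shows "{(u, v). u \<in> A \<and> v \<in> B \<and> x < u + v \<and> u + v \<le> x + c} \<in> sets (borel \<Otimes>\<^sub>M borel)"
proof -
  have "{(u, v). u \<in> A \<and> v \<in> B \<and> x < u + v \<and> u + v \<le> x + c} =
      {p \<in> space (borel \<Otimes>\<^sub>M borel). fst p \<in> A \<and> snd p \<in> B \<and> x < fst p + snd p \<and> fst p + snd p \<le> x + c}"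
    by (auto simp: space_pair_measure)
  also have "\<dots> \<in> sets (borel \<Otimes>\<^sub>M borel)" by measurable
  finally show ?thesis .
qed

text \<open>For independent \<open>U\<close> and \<open>V\<close> with distributions \<open>M\<close> and \<open>N\<close>, this is the probability that \<open>U \<in> A\<close>, \<open>V \<in> B\<close>
and \<open>U + V \<in> x + \<Delta>\<close>.  All estimates of convolutions below restrict the two summands to half-lines
in this way.\<close>

definition joint_prob :: "real \<Rightarrow> real measure \<Rightarrow> real measure \<Rightarrow> real set \<Rightarrow> real set \<Rightarrow> real \<Rightarrow> real"
  where "joint_prob c M N A B x =
    measure (M \<Otimes>\<^sub>M N) {(u, v). u \<in> A \<and> v \<in> B \<and> x < u + v \<and> u + v \<le> x + c}"

lemma joint_prob_nonneg: "0 \<le> joint_prob c M N A B x"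
  by (simp add: joint_prob_def)

context
  fixes M N :: "real measure"
  assumes M: "real_distribution M" and N: "real_distribution N"
begin

interpretation M: real_distribution M by (fact M)
interpretation N: real_distribution N by (fact N)
interpretation P: pair_prob_space M N ..

lemma joint_prob_UNIV: "joint_prob c M N UNIV UNIV x = local_prob c (M \<star> N) x"
proof -
  have "(\<lambda>(u, v). u + v) -` {x<..x + c} \<inter> space (M \<Otimes>\<^sub>M N) =
      {(u, v). u \<in> UNIV \<and> v \<in> UNIV \<and> x < u + v \<and> u + v \<le> x + c}"
    by (auto simp: space_pair_measure)
  then show ?thesis
    unfolding local_prob_def joint_prob_def convolution_def by (subst measure_distr) auto
qed

lemma joint_prob_le_1: "joint_prob c M N A B x \<le> 1"
  unfolding joint_prob_def by (rule P.prob_le_1)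

lemma joint_prob_mono:
  assumes "A \<subseteq> A'" "B \<subseteq> B'" "A' \<in> sets borel" "B' \<in> sets borel"
  shows "joint_prob c M N A B x \<le> joint_prob c M N A' B' x"
  unfolding joint_prob_def
  by (rule P.finite_measure_mono) (use assms in auto)

lemma joint_prob_Un_left:
  assumes "A \<inter> A' = {}" "A \<in> sets borel" "A' \<in> sets borel" "B \<in> sets borel"
  shows "joint_prob c M N (A \<union> A') B x = joint_prob c M N A B x + joint_prob c M N A' B x"
  unfolding joint_prob_def
  by (subst P.finite_measure_Union[symmetric]) (use assms in \<open>auto intro!: arg_cong2[where f=measure]\<close>)

lemma joint_prob_Un_right:
  assumes "B \<inter> B' = {}" "A \<in> sets borel" "B \<in> sets borel" "B' \<in> sets borel"
  shows "joint_prob c M N A (B \<union> B') x = joint_prob c M N A B x + joint_prob c M N A B' x"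
  unfolding joint_prob_def
  by (subst P.finite_measure_Union[symmetric]) (use assms in \<open>auto intro!: arg_cong2[where f=measure]\<close>)

lemma measurable_slice [measurable]:
  assumes [measurable]: "A \<in> sets borel"
  shows "(\<lambda>v. measure M (A \<inter> {x - v<..x - v + c})) \<in> borel_measurable borel"
proof -
  have "(\<lambda>v. emeasure M ((\<lambda>u. (u, v)) -` {(u, v). u \<in> A \<and> v \<in> UNIV \<and> x < u + v \<and> u + v \<le> x + c}))
      \<in> borel_measurable N"
    using joint_event_sets[of A UNIV] by (intro P.measurable_emeasure_Pair2) simp
  also have "(\<lambda>v. (\<lambda>u. (u, v)) -` {(u, v). u \<in> A \<and> v \<in> UNIV \<and> x < u + v \<and> u + v \<le> x + c}) =
      (\<lambda>v. A \<inter> {x - v<..x - v + c})"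
    by (auto simp: fun_eq_iff)
  finally have "(\<lambda>v. emeasure M (A \<inter> {x - v<..x - v + c})) \<in> borel_measurable N"
    by (simp add: fun_eq_iff) 
  then show ?thesis
    unfolding measure_def by simp
qed

lemma joint_prob_integral:
  assumes [measurable]: "A \<in> sets borel" "B \<in> sets borel"
  shows "joint_prob c M N A B x = (\<integral>v. indicator B v * measure M (A \<inter> {x - v<..x - v + c}) \<partial>N)"
proof -
  let ?S = "{(u, v). u \<in> A \<and> v \<in> B \<and> x < u + v \<and> u + v \<le> x + c}"
  have *: "emeasure M ((\<lambda>u. (u, v)) -` ?S) =
      ennreal (indicator B v * measure M (A \<inter> {x - v<..x - v + c}))" for v
  proof -
    have "(\<lambda>u. (u, v)) -` ?S = (if v \<in> B then A \<inter> {x - v<..x - v + c} else {})"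
      by auto
    then show ?thesis
      by (auto simp: M.emeasure_eq_measure)
  qed
  have "emeasure (M \<Otimes>\<^sub>M N) ?S =
      (\<integral>\<^sup>+v. ennreal (indicator B v * measure M (A \<inter> {x - v<..x - v + c})) \<partial>N)"
    using joint_event_sets[of A B] by (subst P.emeasure_pair_measure_alt2) (simp_all add: * del: vimage_Collect_eq)
  also have "\<dots> = ennreal (\<integral>v. indicator B v * measure M (A \<inter> {x - v<..x - v + c}) \<partial>N)"
    by (intro nn_integral_eq_integral N.integrable_const_bound[where B=1])
      (auto simp: indicator_def)
  finally show ?thesis
    unfolding joint_prob_def measure_def by (simp add: integral_nonneg_AE)
qed

lemma joint_prob_UNIV_integral:
  assumes "B \<in> sets borel"
  shows "joint_prob c M N UNIV B x = (\<integral>v. indicator B v * local_prob c M (x - v) \<partial>N)"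
  using joint_prob_integral[of UNIV B] assms by (simp add: local_prob_def)

end

lemma joint_prob_commute:
  assumes M: "real_distribution M" and N: "real_distribution N"
    and A: "A \<in> sets borel" "B \<in> sets borel"
  shows "joint_prob c M N A B x = joint_prob c N M B A x"
proof -
  interpret M: real_distribution M by fact
  interpret N: real_distribution N by fact
  interpret P: pair_prob_space M N ..
  interpret Q: pair_prob_space N M ..
  note [measurable] = A
  have "measure (M \<Otimes>\<^sub>M N) {(u, v). u \<in> A \<and> v \<in> B \<and> x < u + v \<and> u + v \<le> x + c} =
    measure (N \<Otimes>\<^sub>M M) ((\<lambda>(x, y). (y, x)) -` {(u, v). u \<in> A \<and> v \<in> B \<and> x < u + v \<and> u + v \<le> x + c} \<inter> space (N \<Otimes>\<^sub>M M))"
    by (subst P.distr_pair_swap, subst measure_distr) (auto intro!: measurable_pair_swap')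
  also have "(\<lambda>(x, y). (y, x)) -` {(u, v). u \<in> A \<and> v \<in> B \<and> x < u + v \<and> u + v \<le> x + c} \<inter> space (N \<Otimes>\<^sub>M M)
    = {(u, v). u \<in> B \<and> v \<in> A \<and> x < u + v \<and> u + v \<le> x + c}"
    by (auto simp: space_pair_measure add.commute)
  finally show ?thesis unfolding joint_prob_def .
qed

text \<open>Either one summand stays below \<open>a\<close>, or both exceed it; both cannot stay below \<open>a\<close> once
  \<open>x \<ge> 2 a\<close>.\<close>

lemma local_prob_convolution_split:
  assumes M: "real_distribution M" and N: "real_distribution N" and x: "2 * a \<le> x"
  shows "local_prob c (M \<star> N) x =
    joint_prob c M N UNIV {..a} x + joint_prob c N M UNIV {..a} x + joint_prob c M N {a<..} {a<..} x"
proof -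
  have U: "UNIV = {..a} \<union> {a<..}" by auto
  have "joint_prob c M N {..a} {..a} x = 0"
  proof -
    have "{(u, v). u \<in> {..a} \<and> v \<in> {..a} \<and> x < u + v \<and> u + v \<le> x + c} = {}"
      using x by auto
    then show ?thesis unfolding joint_prob_def by (simp only: measure_empty)
  qed
  moreover have "joint_prob c M N UNIV B x = joint_prob c M N {..a} B x + joint_prob c M N {a<..} B x"
    if "B \<in> sets borel" for B
    by (subst U, rule joint_prob_Un_left[OF M N]) (use that in auto)
  moreover have "joint_prob c M N A UNIV x = joint_prob c M N A {..a} x + joint_prob c M N A {a<..} x"
    if "A \<in> sets borel" for A
    by (subst U, rule joint_prob_Un_right[OF M N]) (use that in auto)
  moreover have "joint_prob c N M UNIV {..a} x = joint_prob c M N {..a} UNIV x"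
    by (rule joint_prob_commute[OF N M]) auto
  ultimately show ?thesis
    by (simp add: joint_prob_UNIV[OF M N, symmetric])
qed

section \<open>Long-tailed reference distributions\<close>

text \<open>All local probabilities will be compared with \<open>\<tau> x = F (x + \<Delta>)\<close> for a fixed long-tailed \<open>F\<close>.\<close>

locale local_reference =
  fixes c :: real and F :: "real measure"
  assumes c_pos: "c > 0" and F_L: "F \<in> L_Delta c"
begin

abbreviation \<tau> :: "real \<Rightarrow> real" where "\<tau> \<equiv> local_prob c F"

lemma F_dist: "real_distribution F"
  using F_L by (simp add: L_Delta_def)

lemma tau_long_tailed: "long_tailed \<tau>"
  using F_L by (simp add: L_Delta_def)

lemma tau_measurable [measurable]: "\<tau> \<in> borel_measurable borel"
  using tau_long_tailed by (simp add: long_tailed_def)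

lemma tau_pos: "eventually (\<lambda>x. 0 < \<tau> x) at_top"
  using tau_long_tailed by (auto simp: long_tailed_def eventually_at_top_linorder)

lemma tau_shift_pos:
  assumes "y > 0"
  shows "((\<lambda>x. \<tau> (x + y) / \<tau> x) \<longlongrightarrow> 1) at_top"
proof -
  have "(\<lambda>x. \<tau> (x + y)) \<sim>[at_top] \<tau>"
    using tau_long_tailed assms by (simp add: long_tailed_def)
  from asymp_equivD[OF this] show ?thesis
    by (rule Lim_transform_eventually) (use tau_pos in eventually_elim, auto)
qed

lemma tau_shift: "((\<lambda>x. \<tau> (x + y) / \<tau> x) \<longlongrightarrow> 1) at_top"
proof -
  consider "y > 0" | "y = 0" | "y < 0" by linarith
  then show ?thesis
  proof cases
    case 2
    have "eventually (\<lambda>x. \<tau> (x + y) / \<tau> x = 1) at_top"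
      using tau_pos by eventually_elim (simp add: 2)
    then show ?thesis by (rule tendsto_eventually)
  next
    case 3
    have "((\<lambda>x. \<tau> (x + - y) / \<tau> x) \<longlongrightarrow> 1) at_top"
      using 3 by (intro tau_shift_pos) simp
    from filterlim_compose[OF this filterlim_add_const_at_top[of y]]
    have "((\<lambda>x. inverse (\<tau> (x + y + - y) / \<tau> (x + y))) \<longlongrightarrow> inverse 1) at_top"
      by (intro tendsto_inverse) auto
    then show ?thesis by (simp add: field_simps)
  qed (rule tau_shift_pos)
qed

text \<open>An interval of length \<open>c\<close> is covered by two adjacent ones with prescribed left end.  Although long
tails say nothing about intervals shorter than \<open>c\<close>, this turns information about finitely
many shifts into information about a continuum of shifts.\<close>

lemma local_prob_cover:
  assumes "real_distribution M" "w \<le> z" "z \<le> w + c"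
  shows "local_prob c M z \<le> local_prob c M w + local_prob c M (w + c)"
proof -
  interpret M: real_distribution M by fact
  have "local_prob c M z \<le> measure M ({w<..w + c} \<union> {w + c<..w + c + c})"
    unfolding local_prob_def by (rule M.finite_measure_mono) (use assms in auto)
  also have "\<dots> = local_prob c M w + local_prob c M (w + c)"
    unfolding local_prob_def by (rule M.finite_measure_Union) auto
  finally show ?thesis .
qed

text \<open>Covering with a grid of mesh \<open>c\<close> replaces the uniform convergence theorem for slowly varying functions:
two grid points, each with a factor 2, give the constant 4.\<close>

lemma tau_compact: "eventually (\<lambda>x. \<forall>z\<in>{x - a..x + b}. \<tau> z \<le> 4 * \<tau> x) at_top"
proof -
  obtain N :: nat where N: "(a + b) / c < real N"
    using reals_Archimedean2 by blast
  have "eventually (\<lambda>x. \<tau> (x - a + real k * c) \<le> 2 * \<tau> x) at_top" for k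
  proof -
    have "eventually (\<lambda>x. \<tau> (x + (real k * c - a)) / \<tau> x < 2) at_top"
      using order_tendstoD(2)[OF tau_shift, of 2] by simp
    with tau_pos show ?thesis
      by eventually_elim (simp add: field_simps add_diff_eq)
  qed
  then have "eventually (\<lambda>x. \<forall>k\<in>{..Suc N}. \<tau> (x - a + real k * c) \<le> 2 * \<tau> x) at_top"
    by (intro eventually_ball_finite) auto
  then show ?thesis
  proof eventually_elim
    case (elim x)
    show ?case
    proof
      fix z assume z: "z \<in> {x - a..x + b}"
      \<comment> \<open>The last grid point \<open>x - a + k c\<close> that is not beyond \<open>z\<close>.\<close>
      define k where "k = nat \<lfloor>(z - x + a) / c\<rfloor>"
      have "0 \<le> (z - x + a) / c" using z c_pos by auto
      then have k: "real k \<le> (z - x + a) / c" "(z - x + a) / c < real k + 1"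
        unfolding k_def by linarith+
      have "(z - x + a) / c \<le> (a + b) / c"
        using z c_pos by (intro divide_right_mono) auto
      with N k have "real k < real N" by linarith
      then have "k \<le> N" by simp
      have "\<tau> z \<le> \<tau> (x - a + real k * c) + \<tau> (x - a + real k * c + c)"
        using k c_pos by (intro local_prob_cover F_dist) (auto simp: field_simps)
      also have "x - a + real k * c + c = x - a + real (Suc k) * c"
        by (simp add: algebra_simps)
      also have "\<tau> (x - a + real k * c) + \<tau> (x - a + real (Suc k) * c) \<le> 2 * \<tau> x + 2 * \<tau> x"
        using elim \<open>k \<le> N\<close> by (intro add_mono) (auto simp del: of_nat_Suc)
      finally show "\<tau> z \<le> 4 * \<tau> x" by simp
    qed
  qed
qed

text \<open>The alternative between the two hypotheses of the theorem: the reference is almost decreasing, or the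
distribution lives on the half-line.  In the first case large negative summands are harmless, in the
second they do not occur.\<close>

definition admissible :: "real measure \<Rightarrow> bool" where
  "admissible M \<longleftrightarrow> real_distribution M \<and> (F \<in> D_Delta c \<or> (AE v in M. 0 \<le> v))"

lemma admissible_dist: "admissible M \<Longrightarrow> real_distribution M"
  by (simp add: admissible_def)

lemma admissible_AE: "admissible M \<Longrightarrow> AE v in M. F \<in> D_Delta c \<or> 0 \<le> v"
  by (auto simp: admissible_def)

lemma admissible_convolution: "admissible M \<Longrightarrow> admissible N \<Longrightarrow> admissible (M \<star> N)"
  by (auto simp: admissible_def intro!: real_distribution_convolution AE_nonneg_convolution)

lemma admissible_conv_power: "admissible M \<Longrightarrow> admissible (conv_power M n)"
  by (auto simp: admissible_def intro!: real_distribution_conv_power AE_nonneg_conv_power)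

text \<open>Supplies the dominating function for integrals of \<open>\<tau> (x - v) / \<tau> x\<close>: \<open>z = x - v\<close> with an admissible summand \<open>v \<le> a\<close> is at least
\<open>x - a\<close>, and either \<open>F\<close> is almost decreasing or \<open>v \<ge> 0\<close> forces \<open>z\<close> into a window of bounded length.\<close>

lemma tau_dominates_beyond:
  "\<exists>K>0. eventually (\<lambda>x. \<forall>z\<ge>x - a. F \<in> D_Delta c \<or> z \<le> x \<longrightarrow> \<tau> z \<le> K * \<tau> x) at_top"
proof (cases "F \<in> D_Delta c")
  case True
  then obtain x0 K where K: "K > 0" "\<And>x y. x > x0 \<Longrightarrow> y > 0 \<Longrightarrow> \<tau> (x + y) \<le> K * \<tau> x"
    unfolding D_Delta_def almost_decreasing_def by blast
  have "eventually (\<lambda>x. \<forall>z\<ge>x - a. \<tau> z \<le> K * 4 * \<tau> x) at_top"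
    using tau_compact[of "\<bar>a\<bar> + 1" 0] eventually_gt_at_top[of "x0 + \<bar>a\<bar> + 1"]
  proof eventually_elim
    case (elim x)
    show ?case
    proof (intro allI impI)
      fix z assume z: "x - a \<le> z"
      \<comment> \<open>A point strictly below \<open>z\<close>, as almost decrease compares distinct points only.\<close>
      define w where "w = x - \<bar>a\<bar> - 1"
      have "\<tau> z \<le> K * \<tau> w"
        using K(2)[of w "z - w"] z elim(2) by (auto simp: w_def)
      also have "\<dots> \<le> K * (4 * \<tau> x)"
        using K(1) elim(1) by (intro mult_left_mono) (auto simp: w_def)
      finally show "\<tau> z \<le> K * 4 * \<tau> x" by simp
    qed
  qed
  then show ?thesis
    using K(1) by (intro exI[of _ "K * 4"]) (auto elim!: eventually_mono)
next
  case False
  then show ?thesis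
    using tau_compact[of a 0] by (intro exI[of _ 4]) (auto elim!: eventually_mono)
qed

text \<open>\<open>r\<close> is the local ratio of \<open>M\<close> with respect to \<open>F\<close>, up to a function that vanishes at infinity.  It need not
converge; only a bounded representative is asked for, so that it can be convolved with any
distribution.\<close>

definition local_asymp :: "real measure \<Rightarrow> (real \<Rightarrow> real) \<Rightarrow> bool" where
  "local_asymp M r \<longleftrightarrow> admissible M \<and> r \<in> borel_measurable borel \<and> (\<exists>B. \<forall>x. \<bar>r x\<bar> \<le> B) \<and>
     ((\<lambda>x. local_prob c M x / \<tau> x - r x) \<longlongrightarrow> 0) at_top"

lemma local_asymp_bound:
  assumes "local_asymp M r"
  shows "\<exists>C>0. eventually (\<lambda>x. local_prob c M x \<le> C * \<tau> x) at_top"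
proof -
  obtain B where B: "\<And>x. \<bar>r x\<bar> \<le> B" and
    lim: "((\<lambda>x. local_prob c M x / \<tau> x - r x) \<longlongrightarrow> 0) at_top"
    using assms by (auto simp: local_asymp_def)
  have "eventually (\<lambda>x. local_prob c M x / \<tau> x - r x < 1) at_top"
    using order_tendstoD(2)[OF lim, of 1] by simp
  with tau_pos have "eventually (\<lambda>x. local_prob c M x \<le> (B + 1) * \<tau> x) at_top"
  proof eventually_elim
    case (elim x)
    have "local_prob c M x / \<tau> x \<le> B + 1"
      using elim(2) B[of x] by linarith
    with elim(1) show ?case by (simp add: field_simps)
  qed
  moreover have "B + 1 > 0" using B[of 0] by linarith
  ultimately show ?thesis by blast
qed

text \<open>If the second summand is at most \<open>a\<close>, then the first one is large, and \<open>\<tau> (x - v) \<sim> \<tau> x\<close> for each fixed \<open>v\<close>;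
the bound of \<open>tau_dominates_beyond\<close> makes this a case of dominated convergence.\<close>

lemma truncated_convolution:
  assumes M: "local_asymp M r" and N: "admissible N"
  shows "((\<lambda>x. joint_prob c M N UNIV {..a} x / \<tau> x - (\<integral>v. indicator {..a} v * r (x - v) \<partial>N))
            \<longlongrightarrow> 0) at_top"
proof -
  obtain B where B: "\<And>x. \<bar>r x\<bar> \<le> B" and r [measurable]: "r \<in> borel_measurable borel" and
    lim: "((\<lambda>x. local_prob c M x / \<tau> x - r x) \<longlongrightarrow> 0) at_top" and M': "real_distribution M"
    using M by (auto simp: local_asymp_def admissible_def)
  interpret N: real_distribution N using N by (rule admissible_dist)
  note [measurable] = borel_measurable_local_prob[OF M' c_pos]
  obtain C where "C > 0" "eventually (\<lambda>x. local_prob c M x \<le> C * \<tau> x) at_top"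
    using local_asymp_bound[OF M] by blast
  then obtain x0 where C: "C > 0" "\<And>x. x \<ge> x0 \<Longrightarrow> local_prob c M x \<le> C * \<tau> x"
    by (auto simp: eventually_at_top_linorder)
  obtain K where K: "K > 0"
    "eventually (\<lambda>x. \<forall>z\<ge>x - a. F \<in> D_Delta c \<or> z \<le> x \<longrightarrow> \<tau> z \<le> K * \<tau> x) at_top"
    using tau_dominates_beyond by blast
  let ?g = "\<lambda>x v. indicator {..a} v * (local_prob c M (x - v) / \<tau> x - r (x - v))"
  have "((\<lambda>x. \<integral>v. ?g x v \<partial>N) \<longlongrightarrow> (\<integral>v. 0 \<partial>N)) at_top"
  proof (rule integral_dominated_convergence_at_top[where w="\<lambda>_. C * K + B"])
    have "((\<lambda>x. ?g x v) \<longlongrightarrow> 0) at_top" for v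
    proof -
      have sh: "filterlim (\<lambda>x. x - v) at_top (at_top :: real filter)"
        using filterlim_add_const_at_top[of "-v"] by simp
      have ev: "eventually (\<lambda>x. 0 < \<tau> (x - v)) at_top"
        using eventually_compose_filterlim[OF tau_pos sh] .
      have 1: "((\<lambda>x. local_prob c M (x - v) / \<tau> (x - v) - r (x - v)) \<longlongrightarrow> 0) at_top"
        using filterlim_compose[OF lim sh] .
      have 2: "((\<lambda>x. \<tau> (x - v) / \<tau> x) \<longlongrightarrow> 1) at_top"
        using tau_shift[of "- v"] by simp
      have "((\<lambda>x. \<tau> (x - v) / \<tau> x - 1) \<longlongrightarrow> 0) at_top"
        using tendsto_diff[OF 2 tendsto_const[of 1]] by simp
      then have "((\<lambda>x. B * \<bar>\<tau> (x - v) / \<tau> x - 1\<bar>) \<longlongrightarrow> 0) at_top"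
        by (intro tendsto_mult_right_zero tendsto_rabs_zero)
      then have 3: "((\<lambda>x. r (x - v) * (\<tau> (x - v) / \<tau> x - 1)) \<longlongrightarrow> 0) at_top"
        by (rule Lim_null_comparison[rotated]) (auto simp: abs_mult intro!: always_eventually mult_right_mono B)
      have "((\<lambda>x. (local_prob c M (x - v) / \<tau> (x - v) - r (x - v)) * (\<tau> (x - v) / \<tau> x)
            + r (x - v) * (\<tau> (x - v) / \<tau> x - 1)) \<longlongrightarrow> 0 * 1 + 0) at_top"
        by (intro tendsto_add tendsto_mult 1 2 3)
      then have "((\<lambda>x. local_prob c M (x - v) / \<tau> x - r (x - v)) \<longlongrightarrow> 0 * 1 + 0) at_top"
        by (rule Lim_transform_eventually)
          (use ev in eventually_elim, simp add: left_diff_distrib right_diff_distrib diff_divide_distrib)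
      then have "((\<lambda>x. local_prob c M (x - v) / \<tau> x - r (x - v)) \<longlongrightarrow> 0) at_top"
        by simp
      then show ?thesis by (rule tendsto_mult_right_zero)
    qed
    then show "AE v in N. ((\<lambda>x. ?g x v) \<longlongrightarrow> 0) at_top" by simp
    show "eventually (\<lambda>x. AE v in N. norm (?g x v) \<le> C * K + B) at_top"
      using K(2) tau_pos eventually_ge_at_top[of "x0 + a"]
    proof eventually_elim
      case (elim x)
      have "norm (?g x v) \<le> C * K + B" if v: "F \<in> D_Delta c \<or> 0 \<le> v" for v
      proof (cases "v \<le> a")
        case True
        have "local_prob c M (x - v) \<le> C * \<tau> (x - v)"
          using C(2) elim(3) True by auto
        also have "\<dots> \<le> C * (K * \<tau> x)"
          using C(1) elim(1) True v by (intro mult_left_mono) auto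
        finally have "local_prob c M (x - v) / \<tau> x \<le> C * K"
          using elim(2) by (simp add: field_simps)
        moreover have "0 \<le> local_prob c M (x - v) / \<tau> x"
          using elim(2) by (simp add: local_prob_nonneg)
        ultimately show ?thesis
          using B[of "x - v"] True by (simp add: abs_le_iff) 
      next
        case False
        then show ?thesis using C(1) K(1) B[of 0] by (auto intro!: add_nonneg_nonneg)
      qed
      then show ?case
        using admissible_AE[OF N] by (auto elim!: eventually_mono)
    qed
  qed auto
  moreover have "(\<integral>v. ?g x v \<partial>N) =
      joint_prob c M N UNIV {..a} x / \<tau> x - (\<integral>v. indicator {..a} v * r (x - v) \<partial>N)" for x
  proof -
    have 1: "integrable N (\<lambda>v. indicator {..a} v * local_prob c M (x - v))"
      by (rule N.integrable_const_bound[where B=1])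
         (auto simp: indicator_def local_prob_nonneg local_prob_le_1[OF M'])
    have 2: "integrable N (\<lambda>v. indicator {..a} v * r (x - v))"
      using B order_trans[OF abs_ge_zero B]
      by (intro N.integrable_const_bound[where B=B]) (auto simp: indicator_def)
    have "(\<integral>v. ?g x v \<partial>N) = (\<integral>v. indicator {..a} v * local_prob c M (x - v) / \<tau> x
        - indicator {..a} v * r (x - v) \<partial>N)"
      by (simp add: algebra_simps)
    also have "\<dots> = (\<integral>v. indicator {..a} v * local_prob c M (x - v) \<partial>N) / \<tau> x
        - (\<integral>v. indicator {..a} v * r (x - v) \<partial>N)"
      using 1 2 by (subst Bochner_Integration.integral_diff) auto
    finally show ?thesis
      using joint_prob_UNIV_integral[OF M' N.real_distribution_axioms, of "{..a}" c x] by simp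
  qed
  ultimately show ?thesis by simp
qed

text \<open>Replaces \<open>M\<close> by the reference in a joint event.  The threshold drops by \<open>c\<close> because the window
\<open>x - v + \<Delta>\<close> may stick out of \<open>{a<..}\<close> on the left, while only full windows can be compared.\<close>

lemma joint_prob_dominated:
  assumes M: "real_distribution M" and N: "real_distribution N" and B: "B \<in> sets borel"
    and C: "C \<ge> 0" "\<And>x. x \<ge> x0 \<Longrightarrow> local_prob c M x \<le> C * \<tau> x" and a: "x0 \<le> a - c"
  shows "joint_prob c M N {a<..} B x \<le> C * joint_prob c F N {a - c<..} B x"
proof -
  interpret M: real_distribution M by fact
  interpret N: real_distribution N by fact
  interpret F: real_distribution F by (rule F_dist)
  note [measurable] = B measurable_slice[OF M N] measurable_slice[OF F_dist N]
  have *: "measure M ({a<..} \<inter> {y<..y + c}) \<le> C * measure F ({a - c<..} \<inter> {y<..y + c})" for y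
  proof (cases "y + c \<le> a")
    case True
    then have "{a<..} \<inter> {y<..y + c} = {}" by auto
    then show ?thesis using C(1) by (metis measure_empty measure_nonneg mult_nonneg_nonneg)
  next
    case False
    have "measure M ({a<..} \<inter> {y<..y + c}) \<le> local_prob c M y"
      unfolding local_prob_def by (rule M.finite_measure_mono) auto
    also have "\<dots> \<le> C * \<tau> y" using C(2)[of y] a False by simp
    also have "\<tau> y = measure F ({a - c<..} \<inter> {y<..y + c})"
      unfolding local_prob_def using False by (intro arg_cong2[where f=measure]) auto
    finally show ?thesis .
  qed
  have "joint_prob c M N {a<..} B x = (\<integral>v. indicator B v * measure M ({a<..} \<inter> {x - v<..x - v + c}) \<partial>N)"
    by (rule joint_prob_integral[OF M N]) (use B in auto)
  also have "\<dots> \<le> (\<integral>v. C * (indicator B v * measure F ({a - c<..} \<inter> {x - v<..x - v + c})) \<partial>N)"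
  proof (rule integral_mono)
    show "integrable N (\<lambda>v. indicator B v * measure M ({a<..} \<inter> {x - v<..x - v + c}))"
      by (rule N.integrable_const_bound[where B=1]) (auto simp: indicator_def)
    have "integrable N (\<lambda>v. indicator B v * measure F ({a - c<..} \<inter> {x - v<..x - v + c}))"
      by (rule N.integrable_const_bound[where B=1]) (auto simp: indicator_def)
    then show "integrable N (\<lambda>v. C * (indicator B v * measure F ({a - c<..} \<inter> {x - v<..x - v + c})))"
      by simp
    show "indicator B v * measure M ({a<..} \<inter> {x - v<..x - v + c}) \<le>
        C * (indicator B v * measure F ({a - c<..} \<inter> {x - v<..x - v + c}))" for v
      using *[of "x - v"] by (auto simp: indicator_def)
  qed
  also have "\<dots> = C * joint_prob c F N {a - c<..} B x"
    using joint_prob_integral[OF F_dist N, of "{a - c<..}" B c x] B by simp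
  finally show ?thesis .
qed

end

section \<open>The principle of one big jump\<close>

text \<open>From now on the reference lies in \<open>S_Delta\<close> and meets one of the two hypotheses itself.\<close>

locale subexponential_reference = local_reference +
  assumes F_S: "F \<in> S_Delta c" and F_adm: "admissible F"
begin

lemma local_asymp_self: "local_asymp F (\<lambda>_. 1)"
proof -
  have "eventually (\<lambda>x. \<tau> x / \<tau> x - 1 = 0) at_top"
    using tau_pos by eventually_elim simp
  then show ?thesis
    using F_adm by (auto simp: local_asymp_def intro: tendsto_eventually)
qed

lemma self_convolution_ratio: "((\<lambda>x. local_prob c (F \<star> F) x / \<tau> x) \<longlongrightarrow> 2) at_top"
proof -
  have "local_prob c (F \<star> F) \<sim>[at_top] (\<lambda>x. 2 * \<tau> x)"
    using F_S conv_power_2[OF F_dist] by (simp add: S_Delta_def)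
  from asymp_equivD[OF this]
  have "((\<lambda>x. local_prob c (F \<star> F) x / (2 * \<tau> x)) \<longlongrightarrow> 1) at_top"
    by (rule Lim_transform_eventually) (use tau_pos in eventually_elim, auto)
  from tendsto_mult_left[OF this, of 2] show ?thesis by simp
qed

text \<open>Of the limit 2 for \<open>F * F\<close>, the two events with one moderate summand account for \<open>2 F {..a}\<close>.  What is left
for the event with two large summands tends to 0 as \<open>a \<rightarrow> \<infinity>\<close>.\<close>

lemma self_both_large:
  "((\<lambda>x. joint_prob c F F {a<..} {a<..} x / \<tau> x) \<longlongrightarrow> 2 - 2 * measure F {..a}) at_top"
proof -
  interpret F: real_distribution F by (rule F_dist)
  have "((\<lambda>x. (joint_prob c F F UNIV {..a} x / \<tau> x - measure F {..a}) + measure F {..a})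
        \<longlongrightarrow> 0 + measure F {..a}) at_top"
    using truncated_convolution[OF local_asymp_self F_adm, of a] by (intro tendsto_intros) simp
  then have 1: "((\<lambda>x. joint_prob c F F UNIV {..a} x / \<tau> x) \<longlongrightarrow> measure F {..a}) at_top"
    by simp
  have "((\<lambda>x. local_prob c (F \<star> F) x / \<tau> x - 2 * (joint_prob c F F UNIV {..a} x / \<tau> x))
      \<longlongrightarrow> 2 - 2 * measure F {..a}) at_top"
    by (intro tendsto_intros self_convolution_ratio 1)
  then show ?thesis
  proof (rule Lim_transform_eventually)
    show "eventually (\<lambda>x. local_prob c (F \<star> F) x / \<tau> x - 2 * (joint_prob c F F UNIV {..a} x / \<tau> x) =
        joint_prob c F F {a<..} {a<..} x / \<tau> x) at_top"
      using tau_pos eventually_ge_at_top[of "2 * a"]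
    proof eventually_elim
      case (elim x)
      have "local_prob c (F \<star> F) x / \<tau> x = (joint_prob c F F UNIV {..a} x
          + joint_prob c F F UNIV {..a} x + joint_prob c F F {a<..} {a<..} x) / \<tau> x"
        using local_prob_convolution_split[OF F_dist F_dist elim(2), of c] by simp
      then show ?case by (simp add: add_divide_distrib)
    qed
  qed
qed

text \<open>Each summand in turn is replaced by the reference.\<close>

lemma both_large_dominated:
  assumes M: "real_distribution M" and N: "real_distribution N"
    and C: "C \<ge> 0" "\<And>x. x \<ge> x0 \<Longrightarrow> local_prob c M x \<le> C * \<tau> x"
      "\<And>x. x \<ge> x0 \<Longrightarrow> local_prob c N x \<le> C * \<tau> x"
    and a: "x0 \<le> a - c"
  shows "joint_prob c M N {a<..} {a<..} x \<le> C\<^sup>2 * joint_prob c F F {a - c<..} {a - c<..} x"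
proof -
  have "joint_prob c M N {a<..} {a<..} x \<le> C * joint_prob c F N {a - c<..} {a<..} x"
    by (rule joint_prob_dominated[OF M N _ C(1,2) a]) auto
  also have "joint_prob c F N {a - c<..} {a<..} x = joint_prob c N F {a<..} {a - c<..} x"
    by (rule joint_prob_commute[OF F_dist N]) auto
  also have "C * \<dots> \<le> C * (C * joint_prob c F F {a - c<..} {a - c<..} x)"
    by (intro mult_left_mono joint_prob_dominated[OF N F_dist _ C(1,3) a] C(1)) auto
  finally show ?thesis by (simp add: power2_eq_square mult.assoc)
qed

text \<open>The derivation rule for local ratios.  For a threshold \<open>a\<close>, the sum is split into the events that one
of the summands is at most \<open>a\<close>, which yield the two integrals restricted to \<open>{..a}\<close>, and the event that
both exceed \<open>a\<close>.  The tails of the integrals and the last event are small for large \<open>a\<close>, uniformly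
for large \<open>x\<close>.\<close>

lemma local_asymp_convolution:
  assumes M: "local_asymp M r" and N: "local_asymp N s"
  shows "local_asymp (M \<star> N) (\<lambda>x. (\<integral>v. r (x - v) \<partial>N) + (\<integral>v. s (x - v) \<partial>M))"
proof -
  obtain Br where Br: "\<And>x. \<bar>r x\<bar> \<le> Br" and r [measurable]: "r \<in> borel_measurable borel"
    and M_adm: "admissible M"
    using M by (auto simp: local_asymp_def)
  obtain Bs where Bs: "\<And>x. \<bar>s x\<bar> \<le> Bs" and s [measurable]: "s \<in> borel_measurable borel"
    and N_adm: "admissible N"
    using N by (auto simp: local_asymp_def)
  note M' = admissible_dist[OF M_adm] and N' = admissible_dist[OF N_adm]
  interpret M: real_distribution M by fact
  interpret N: real_distribution N by fact
  define I where "I x = (\<integral>v. r (x - v) \<partial>N) + (\<integral>v. s (x - v) \<partial>M)" for x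
  have I_meas: "I \<in> borel_measurable borel"
    unfolding I_def by measurable
  have I_bound: "\<bar>I x\<bar> \<le> Br + Bs" for x
  proof -
    have "\<bar>\<integral>v. r (x - v) \<partial>N\<bar> \<le> Br" "\<bar>\<integral>v. s (x - v) \<partial>M\<bar> \<le> Bs"
      by (intro abs_integral_le N' M' Br Bs; measurable)+
    then show ?thesis unfolding I_def by linarith
  qed
  obtain CM where CM: "CM > 0" "eventually (\<lambda>x. local_prob c M x \<le> CM * \<tau> x) at_top"
    using local_asymp_bound[OF M] by blast
  obtain CN where CN: "CN > 0" "eventually (\<lambda>x. local_prob c N x \<le> CN * \<tau> x) at_top"
    using local_asymp_bound[OF N] by blast
  define C where "C = max CM CN"
  have "C > 0" using CM(1) by (auto simp: C_def)
  have "eventually (\<lambda>x. local_prob c M x \<le> C * \<tau> x \<and> local_prob c N x \<le> C * \<tau> x) at_top"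
    using CM(2) CN(2)
  proof eventually_elim
    case (elim x)
    have "CM * \<tau> x \<le> C * \<tau> x" "CN * \<tau> x \<le> C * \<tau> x"
      by (auto simp: C_def intro!: mult_right_mono local_prob_nonneg)
    with elim show ?case by linarith
  qed
  then obtain x0 where x0: "\<And>x. x \<ge> x0 \<Longrightarrow> local_prob c M x \<le> C * \<tau> x"
    "\<And>x. x \<ge> x0 \<Longrightarrow> local_prob c N x \<le> C * \<tau> x"
    by (auto simp: eventually_at_top_linorder)
  have "((\<lambda>x. local_prob c (M \<star> N) x / \<tau> x - I x) \<longlongrightarrow> 0) at_top"
  proof (rule tendstoI)
    fix e :: real assume e: "e > 0"
    \<comment> \<open>The error that is independent of \<open>x\<close> once the threshold \<open>a\<close> has been fixed.\<close>
    let ?tail = "\<lambda>a. Br * (1 - measure N {..a}) + Bs * (1 - measure M {..a})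
        + C\<^sup>2 * (2 - 2 * measure F {..a - c})"
    have sh: "filterlim (\<lambda>a. a - c) at_top (at_top :: real filter)"
      using filterlim_add_const_at_top[of "-c"] by simp
    have "(?tail \<longlongrightarrow> Br * (1 - 1) + Bs * (1 - 1) + C\<^sup>2 * (2 - 2 * 1)) at_top"
      by (intro tendsto_intros measure_atMost_tendsto N' M'
          filterlim_compose[OF measure_atMost_tendsto[OF F_dist] sh])
    then have "(?tail \<longlongrightarrow> 0) at_top" by simp
    from order_tendstoD(2)[OF this e] have "eventually (\<lambda>a. ?tail a < e) at_top" .
    with eventually_ge_at_top[of "x0 + c"] have "eventually (\<lambda>a. x0 + c \<le> a \<and> ?tail a < e) at_top"
      by (rule eventually_conj)
    from eventually_happens[OF this] obtain a where a: "x0 + c \<le> a" "?tail a < e"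
      by auto
    let ?J = "\<lambda>x. \<bar>joint_prob c M N UNIV {..a} x / \<tau> x - (\<integral>v. indicator {..a} v * r (x - v) \<partial>N)\<bar>
        + \<bar>joint_prob c N M UNIV {..a} x / \<tau> x - (\<integral>v. indicator {..a} v * s (x - v) \<partial>M)\<bar>
        + C\<^sup>2 * (joint_prob c F F {a - c<..} {a - c<..} x / \<tau> x)
        + Br * (1 - measure N {..a}) + Bs * (1 - measure M {..a})"
    have "(?J \<longlongrightarrow> \<bar>0\<bar> + \<bar>0\<bar> + C\<^sup>2 * (2 - 2 * measure F {..a - c})
        + Br * (1 - measure N {..a}) + Bs * (1 - measure M {..a})) at_top"
      by (intro tendsto_intros truncated_convolution M N M_adm N_adm self_both_large)
    then have "eventually (\<lambda>x. ?J x < e) at_top"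
      by (rule order_tendstoD(2)) (use a(2) in simp)
    then show "eventually (\<lambda>x. dist (local_prob c (M \<star> N) x / \<tau> x - I x) 0 < e) at_top"
      using tau_pos eventually_ge_at_top[of "2 * a"]
    proof eventually_elim
      case (elim x)
      have "x0 \<le> a - c" using a(1) by simp
      have "joint_prob c M N {a<..} {a<..} x / \<tau> x
          \<le> C\<^sup>2 * joint_prob c F F {a - c<..} {a - c<..} x / \<tau> x"
        using elim(2) \<open>C > 0\<close>
        by (intro divide_right_mono both_large_dominated[OF M' N' _ x0 \<open>x0 \<le> a - c\<close>]) auto
      moreover have "0 \<le> joint_prob c M N {a<..} {a<..} x / \<tau> x"
        using elim(2) by (simp add: joint_prob_nonneg)
      moreover have "local_prob c (M \<star> N) x / \<tau> x = joint_prob c M N UNIV {..a} x / \<tau> x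
          + joint_prob c N M UNIV {..a} x / \<tau> x + joint_prob c M N {a<..} {a<..} x / \<tau> x"
        using local_prob_convolution_split[OF M' N' elim(3)] by (simp add: add_divide_distrib)
      ultimately show ?case
        using elim(1) integral_truncation_error[OF N' r Br, of x a]
          integral_truncation_error[OF M' s Bs, of x a]
        unfolding I_def dist_real_def times_divide_eq_right by linarith
    qed
  qed
  then show ?thesis
    using I_meas I_bound admissible_convolution[OF M_adm N_adm]
    unfolding local_asymp_def I_def[symmetric] by blast
qed

section \<open>A geometric bound for convolution powers\<close>

text \<open>Needed to start a bound with the same range of \<open>x\<close> for all convolution powers: on a compact
interval a probability, which is at most 1, is then at most a constant times \<open>\<tau>\<close>.\<close>

lemma tau_bounded_below: "\<exists>x0. \<forall>b. \<exists>\<delta>>0. \<forall>x\<in>{x0..b}. \<delta> \<le> \<tau> x"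
proof -
  have "eventually (\<lambda>x. 0 < \<tau> x \<and> (\<forall>z\<in>{x - 0..x + c}. \<tau> z \<le> 4 * \<tau> x)) at_top"
    using tau_pos tau_compact by (rule eventually_conj)
  then obtain x0 where "\<forall>x\<ge>x0. 0 < \<tau> x \<and> (\<forall>z\<in>{x - 0..x + c}. \<tau> z \<le> 4 * \<tau> x)"
    by (auto simp: eventually_at_top_linorder)
  then have x0: "\<And>x. x \<ge> x0 \<Longrightarrow> 0 < \<tau> x"
    "\<And>x z. x \<ge> x0 \<Longrightarrow> x \<le> z \<Longrightarrow> z \<le> x + c \<Longrightarrow> \<tau> z \<le> 4 * \<tau> x"
    by auto
  have "\<exists>\<delta>>0. \<forall>x\<in>{x0..b}. \<delta> \<le> \<tau> x" for b
  proof (cases "x0 \<le> b")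
    case True
    have *: "\<tau> b \<le> 4 ^ k * \<tau> x" if "x0 \<le> x" "x \<le> b" "b \<le> x + real k * c" for k x
      using that
    proof (induction k arbitrary: x)
      case (Suc k)
      define z where "z = min b (x + c)"
      have "\<tau> b \<le> 4 ^ k * \<tau> z"
        using Suc.prems c_pos by (intro Suc.IH) (auto simp: z_def min_def algebra_simps)
      also have "\<dots> \<le> 4 ^ k * (4 * \<tau> x)"
        using Suc.prems c_pos by (intro mult_left_mono x0(2)) (auto simp: z_def)
      finally show ?case by simp
    qed auto
    obtain k :: nat where k: "(b - x0) / c \<le> real k" using real_arch_simple by blast
    have "\<tau> b / 4 ^ k \<le> \<tau> x" if "x \<in> {x0..b}" for x
    proof -
      have "\<tau> b \<le> 4 ^ k * \<tau> x"
        using that k c_pos by (intro *) (auto simp: field_simps)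
      then show ?thesis by (simp add: field_simps)
    qed
    then show ?thesis
      using x0(1)[OF True] by (intro exI[of _ "\<tau> b / 4 ^ k"]) auto
  qed (auto intro: exI[of _ 1])
  then show ?thesis by blast
qed

text \<open>If the summand with distribution \<open>M\<close> exceeds \<open>x - a\<close>, then conditioning on the other one leaves a window of
\<open>M\<close> that starts beyond \<open>x - a - c\<close>.  The resulting constant does not depend on the other distribution \<open>N\<close>,
which will be a convolution power.\<close>

lemma large_summand_bound:
  assumes M: "local_asymp M r"
  shows "\<exists>C>0. eventually (\<lambda>x. \<forall>N. admissible N \<longrightarrow> joint_prob c N M UNIV {x - a<..} x \<le> C * \<tau> x) at_top"
proof -
  obtain C where "C > 0" "eventually (\<lambda>x. local_prob c M x \<le> C * \<tau> x) at_top"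
    using local_asymp_bound[OF M] by blast
  then obtain x0 where C: "C > 0" "\<And>x. x \<ge> x0 \<Longrightarrow> local_prob c M x \<le> C * \<tau> x"
    by (auto simp: eventually_at_top_linorder)
  have M': "real_distribution M" using M by (auto simp: local_asymp_def admissible_def)
  interpret M: real_distribution M by fact
  obtain K where K: "K > 0"
    "eventually (\<lambda>x. \<forall>z\<ge>x - (a + c). F \<in> D_Delta c \<or> z \<le> x \<longrightarrow> \<tau> z \<le> K * \<tau> x) at_top"
    using tau_dominates_beyond by blast
  have "eventually (\<lambda>x. \<forall>N. admissible N \<longrightarrow> joint_prob c N M UNIV {x - a<..} x \<le> C * K * \<tau> x) at_top"
    using K(2) eventually_ge_at_top[of "x0 + a + c"]
  proof eventually_elim
    case (elim x)
    show ?case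
    proof (intro allI impI)
      fix N assume N: "admissible N"
      note N' = admissible_dist[OF N]
      interpret N: real_distribution N by (rule N')
      note [measurable] = measurable_slice[OF M' N']
      have *: "measure M ({x - a<..} \<inter> {x - u<..x - u + c}) \<le> C * K * \<tau> x"
        if u: "F \<in> D_Delta c \<or> 0 \<le> u" for u
      proof (cases "x - u + c \<le> x - a")
        case True
        then have "{x - a<..} \<inter> {x - u<..x - u + c} = {}" by auto
        then show ?thesis
          using C(1) K(1) by (metis local_prob_nonneg measure_empty mult_nonneg_nonneg less_imp_le)
      next
        case False
        have "measure M ({x - a<..} \<inter> {x - u<..x - u + c}) \<le> local_prob c M (x - u)"
          unfolding local_prob_def by (rule M.finite_measure_mono) auto
        also have "\<dots> \<le> C * \<tau> (x - u)"
          using elim(2) False by (intro C(2)) auto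
        also have "\<dots> \<le> C * (K * \<tau> x)"
          using elim(1) u False C(1) by (intro mult_left_mono) auto
        finally show ?thesis by simp
      qed
      have "joint_prob c N M UNIV {x - a<..} x = joint_prob c M N {x - a<..} UNIV x"
        by (rule joint_prob_commute[OF N' M']) auto
      also have "\<dots> = (\<integral>u. measure M ({x - a<..} \<inter> {x - u<..x - u + c}) \<partial>N)"
        using joint_prob_integral[OF M' N', of "{x - a<..}" UNIV c x] by simp
      also have "\<dots> \<le> (\<integral>u. C * K * \<tau> x \<partial>N)"
        by (rule integral_mono_AE)
          (use admissible_AE[OF N] * in \<open>auto elim!: eventually_mono intro!: N.integrable_const_bound[where B=1]\<close>)
      also have "\<dots> = C * K * \<tau> x" using N.prob_space by simp
      finally show "joint_prob c N M UNIV {x - a<..} x \<le> C * K * \<tau> x" .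
    qed
  qed
  then show ?thesis using C(1) K(1) by (intro exI[of _ "C * K"]) auto
qed

text \<open>A Kesten-type bound.  The weights \<open>\<lambda>\<^sup>n / n!\<close> absorb any geometric factor, so a crude \<open>K\<close> suffices, and the
induction is elementary: if one summand is at most \<open>x - x0\<close>, the induction hypothesis applies to the
others and leads back to \<open>F * M\<close>; if not, \<open>large_summand_bound\<close> applies.\<close>

lemma conv_power_bound:
  assumes M: "local_asymp M r"
  shows "\<exists>K x0. 0 < K \<and> (\<forall>n. \<forall>x\<ge>x0. local_prob c (conv_power M n) x \<le> K ^ n * \<tau> x)"
proof -
  have M_adm: "admissible M" using M by (simp add: local_asymp_def)
  note M' = admissible_dist[OF M_adm]
  interpret M: real_distribution M by (rule M')
  obtain C1 where C1: "C1 > 0" "eventually (\<lambda>x. local_prob c (F \<star> M) x \<le> C1 * \<tau> x) at_top"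
    using local_asymp_bound[OF local_asymp_convolution[OF local_asymp_self M]] by blast
  obtain xb where xb: "\<And>b. \<exists>\<delta>>0. \<forall>x\<in>{xb..b}. \<delta> \<le> \<tau> x"
    using tau_bounded_below by blast
  obtain x0' where x0': "\<And>x. x \<ge> x0' \<Longrightarrow> local_prob c (F \<star> M) x \<le> C1 * \<tau> x"
    using C1(2) by (auto simp: eventually_at_top_linorder)
  \<comment> \<open>\<open>x0 \<ge> 0\<close> covers \<open>n = 0\<close>, where the local probability vanishes since the point mass sits at 0.\<close>
  define x0 where "x0 = max 0 (max xb x0')"
  obtain C2 where C2: "C2 > 0"
    "eventually (\<lambda>x. \<forall>N. admissible N \<longrightarrow> joint_prob c N M UNIV {x - x0<..} x \<le> C2 * \<tau> x) at_top"
    using large_summand_bound[OF M] by blast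
  then obtain x1 where x1: "\<And>x N. x \<ge> x1 \<Longrightarrow> admissible N \<Longrightarrow> joint_prob c N M UNIV {x - x0<..} x \<le> C2 * \<tau> x"
    by (auto simp: eventually_at_top_linorder)
  obtain \<delta> where \<delta>: "\<delta> > 0" "\<And>x. xb \<le> x \<Longrightarrow> x \<le> x1 \<Longrightarrow> \<delta> \<le> \<tau> x"
    using xb[of x1] by auto
  \<comment> \<open>The bound by \<open>C2\<close> holds beyond \<open>x1\<close> only; on \<open>{x0..x1}\<close> the term \<open>1 / \<delta>\<close> takes over.\<close>
  define C3 where "C3 = C2 + 1 / \<delta>"
  have C3: "joint_prob c N M UNIV {x - x0<..} x \<le> C3 * \<tau> x" if "x \<ge> x0" "admissible N" for x N
  proof (cases "x \<ge> x1")
    case True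
    have "C2 * \<tau> x \<le> C3 * \<tau> x"
      using \<delta>(1) by (auto simp: C3_def intro!: mult_right_mono local_prob_nonneg)
    with x1[OF True that(2)] show ?thesis by linarith
  next
    case False
    have "joint_prob c N M UNIV {x - x0<..} x \<le> 1"
      by (rule joint_prob_le_1[OF admissible_dist[OF that(2)] M'])
    also have "1 \<le> 1 / \<delta> * \<tau> x"
      using \<delta>(1) \<delta>(2)[of x] that(1) False by (auto simp: x0_def field_simps)
    also have "\<dots> \<le> C3 * \<tau> x"
      unfolding C3_def by (intro mult_right_mono local_prob_nonneg) (use C2(1) in simp)
    finally show ?thesis .
  qed
  define K where "K = C1 + C3 + 1"
  have "C3 > 0" using C2(1) \<delta>(1) by (simp add: C3_def add_pos_pos)
  then have K: "K \<ge> 1" "K > 0" using C1(1) by (auto simp: K_def)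
  have "\<forall>x\<ge>x0. local_prob c (conv_power M n) x \<le> K ^ n * \<tau> x" for n
  proof (induction n)
    case 0
    have "local_prob c (return borel 0) x = 0" if "x \<ge> x0" for x
      using that unfolding local_prob_def x0_def by (subst measure_return) (auto simp: indicator_def)
    then show ?case by (simp add: local_prob_nonneg)
  next
    case (Suc n)
    define N where "N = conv_power M n"
    have N: "admissible N" unfolding N_def by (rule admissible_conv_power[OF M_adm])
    note N' = admissible_dist[OF N]
    interpret N: real_distribution N by (rule N')
    note [measurable] = borel_measurable_local_prob[OF N' c_pos]
    show ?case
    proof (intro allI impI)
      fix x assume x: "x \<ge> x0"
      have "local_prob c (conv_power M (Suc n)) x = joint_prob c N M UNIV ({..x - x0} \<union> {x - x0<..}) x"
      proof -
        have "local_prob c (M \<star> N) x = joint_prob c M N UNIV UNIV x"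
          by (rule joint_prob_UNIV[OF M' N', symmetric])
        also have "\<dots> = joint_prob c N M UNIV UNIV x"
          by (rule joint_prob_commute[OF M' N']) auto
        also have "\<dots> = joint_prob c N M UNIV ({..x - x0} \<union> {x - x0<..}) x"
          by (rule arg_cong[where f="\<lambda>B. joint_prob c N M UNIV B x"]) auto
        finally show ?thesis by (simp add: N_def)
      qed
      also have "\<dots> = joint_prob c N M UNIV {..x - x0} x + joint_prob c N M UNIV {x - x0<..} x"
        by (rule joint_prob_Un_right[OF N' M']) auto
      also have "joint_prob c N M UNIV {..x - x0} x \<le> K ^ n * C1 * \<tau> x"
      proof -
        have "joint_prob c N M UNIV {..x - x0} x = (\<integral>v. indicator {..x - x0} v * local_prob c N (x - v) \<partial>M)"
          by (rule joint_prob_UNIV_integral[OF N' M']) auto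
        also have "\<dots> \<le> (\<integral>v. K ^ n * (indicator {..x - x0} v * \<tau> (x - v)) \<partial>M)"
        proof (rule integral_mono)
          show "integrable M (\<lambda>v. indicator {..x - x0} v * local_prob c N (x - v))"
            by (rule M.integrable_const_bound[where B=1])
               (auto simp: indicator_def local_prob_nonneg local_prob_le_1[OF N'])
          have "integrable M (\<lambda>v. indicator {..x - x0} v * \<tau> (x - v))"
            by (rule M.integrable_const_bound[where B=1])
               (auto simp: indicator_def local_prob_nonneg local_prob_le_1[OF F_dist])
          then show "integrable M (\<lambda>v. K ^ n * (indicator {..x - x0} v * \<tau> (x - v)))" by simp
          show "indicator {..x - x0} v * local_prob c N (x - v) \<le> K ^ n * (indicator {..x - x0} v * \<tau> (x - v))" for v
            using Suc.IH by (auto simp: indicator_def N_def)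
        qed
        also have "\<dots> = K ^ n * joint_prob c F M UNIV {..x - x0} x"
          using joint_prob_UNIV_integral[OF F_dist M', of "{..x - x0}" c x] by simp
        also have "\<dots> \<le> K ^ n * joint_prob c F M UNIV UNIV x"
          using K by (intro mult_left_mono joint_prob_mono[OF F_dist M']) auto
        also have "\<dots> = K ^ n * local_prob c (F \<star> M) x"
          by (simp add: joint_prob_UNIV[OF F_dist M'])
        also have "\<dots> \<le> K ^ n * (C1 * \<tau> x)"
          using K x by (intro mult_left_mono x0') (auto simp: x0_def)
        finally show ?thesis by (simp add: mult.assoc)
      qed
      also have "joint_prob c N M UNIV {x - x0<..} x \<le> K ^ n * C3 * \<tau> x"
      proof -
        have "joint_prob c N M UNIV {x - x0<..} x \<le> 1 * (C3 * \<tau> x)"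
          using C3[OF x N] by simp
        also have "\<dots> \<le> K ^ n * (C3 * \<tau> x)"
          using K \<open>C3 > 0\<close> by (intro mult_right_mono mult_nonneg_nonneg local_prob_nonneg) auto
        finally show ?thesis by (simp add: mult.assoc)
      qed
      also have "K ^ n * C1 * \<tau> x + K ^ n * C3 * \<tau> x \<le> K ^ Suc n * \<tau> x"
      proof -
        have "K ^ n * (C1 + C3) * \<tau> x \<le> K ^ n * K * \<tau> x"
          using K by (intro mult_right_mono mult_left_mono local_prob_nonneg) (auto simp: K_def)
        then show ?thesis by (simp add: algebra_simps)
      qed
      finally show "local_prob c (conv_power M (Suc n)) x \<le> K ^ Suc n * \<tau> x" by simp
    qed
  qed
  then show ?thesis using K by blast
qed

end

section \<open>Exponential series and their inversion\<close>

lemma summable_exp_real: "summable (\<lambda>n. l ^ n / fact n :: real)"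
  using summable_exp_generic[of l] by (simp add: divide_inverse mult.commute)

lemma exp_real_sums: "(\<lambda>n. l ^ n / fact n :: real) sums exp l"
  using exp_converges[of l] by (simp add: divide_inverse mult.commute)

lemma summable_exp_bounded:
  fixes w :: "nat \<Rightarrow> real"
  assumes "\<And>n. \<bar>w n\<bar> \<le> B"
  shows "summable (\<lambda>n. l ^ n / fact n * w n)"
proof (rule summable_comparison_test'[where N=0])
  show "summable (\<lambda>n. \<bar>l\<bar> ^ n / fact n * B)"
    by (intro summable_mult2 summable_exp_real)
  fix n
  have "norm (l ^ n / fact n * w n) = \<bar>l\<bar> ^ n / fact n * \<bar>w n\<bar>"
    by (simp add: abs_mult power_abs)
  also have "\<dots> \<le> \<bar>l\<bar> ^ n / fact n * B"
    by (rule mult_left_mono[OF assms]) simp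
  finally show "norm (l ^ n / fact n * w n) \<le> \<bar>l\<bar> ^ n / fact n * B" .
qed

lemma abs_exp_series_le:
  fixes w :: "nat \<Rightarrow> real"
  assumes "\<And>n. \<bar>w n\<bar> \<le> B" "l \<ge> 0"
  shows "\<bar>\<Sum>n. l ^ n / fact n * w n\<bar> \<le> exp l * B"
proof -
  have 1: "summable (\<lambda>n. l ^ n / fact n * \<bar>w n\<bar>)"
    by (rule summable_exp_bounded[where B=B]) (use assms in auto)
  have "\<bar>\<Sum>n. l ^ n / fact n * w n\<bar> \<le> (\<Sum>n. \<bar>l ^ n / fact n * w n\<bar>)"
    by (rule summable_rabs) (use 1 assms in \<open>simp add: abs_mult\<close>)
  also have "\<dots> = (\<Sum>n. l ^ n / fact n * \<bar>w n\<bar>)"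
    using assms by (simp add: abs_mult)
  also have "\<dots> \<le> (\<Sum>n. l ^ n / fact n * B)"
  proof (rule suminf_le[OF _ 1])
    show "l ^ n / fact n * \<bar>w n\<bar> \<le> l ^ n / fact n * B" for n
      by (rule mult_left_mono[OF assms(1)]) (use assms(2) in simp)
    show "summable (\<lambda>n. l ^ n / fact n * B)"
      by (intro summable_mult2 summable_exp_real)
  qed
  also have "\<dots> = exp l * B"
    using sums_mult2[OF exp_real_sums[of l], of B] by (rule sums_unique[symmetric])
  finally show ?thesis .
qed

lemma exp_series_shift:
  fixes w :: "nat \<Rightarrow> real"
  assumes "\<And>n. \<bar>w n\<bar> \<le> B"
  shows "(\<lambda>n. l ^ n / fact n * (real n * w (n - 1))) sums (l * (\<Sum>n. l ^ n / fact n * w n))"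
proof -
  have "(\<lambda>n. l * (l ^ n / fact n * w n)) sums (l * (\<Sum>n. l ^ n / fact n * w n))"
    by (intro sums_mult summable_sums summable_exp_bounded[where B=B] assms)
  also have "(\<lambda>n. l * (l ^ n / fact n * w n)) =
      (\<lambda>n. l ^ Suc n / fact (Suc n) * (real (Suc n) * w (Suc n - 1)))"
    by (simp add: fun_eq_iff field_simps del: of_nat_Suc)
  finally show ?thesis
    by (subst (asm) sums_Suc_iff) simp
qed

text \<open>The series form of \<open>exp (-l T) (exp (l T) w) = w\<close> for the shift \<open>T\<close> of bounded sequences, evaluated at index
0.  The double series converges absolutely, and by the binomial theorem its \<open>N\<close>-th diagonal is
\<open>w N (l - l)\<^sup>N / N!\<close>.\<close>

lemma exp_series_inversion:
  fixes w :: "nat \<Rightarrow> real"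
  assumes B: "\<And>n. \<bar>w n\<bar> \<le> B" and l: "l \<ge> 0"
  shows "(\<lambda>j. (- l) ^ j / fact j * (\<Sum>n. l ^ n / fact n * w (n + j))) sums w 0"
proof -
  define a where "a = (\<lambda>(j, n). (- l) ^ j / fact j * (l ^ n / fact n * w (n + j)))"
  have ex: "((\<lambda>n. l ^ n / fact n) has_sum exp l) UNIV"
    using l by (intro norm_summable_imp_has_sum exp_real_sums) (simp add: summable_exp_real)
  have dom: "(\<lambda>(j, n). (l ^ j / fact j) * (l ^ n / fact n) * B) summable_on UNIV \<times> UNIV"
  proof -
    have "((\<lambda>n. (l ^ j / fact j) * (l ^ n / fact n)) has_sum (l ^ j / fact j) * exp l) UNIV" for j
      by (rule has_sum_cmult_right[OF ex])
    moreover have "(\<lambda>j. (l ^ j / fact j) * exp l) summable_on UNIV"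
      by (rule has_sum_imp_summable[OF has_sum_cmult_left[OF ex]])
    ultimately have "(\<lambda>(j, n). (l ^ j / fact j) * (l ^ n / fact n)) summable_on UNIV \<times> UNIV"
      using l by (intro summable_on_SigmaI[where g="\<lambda>j. (l ^ j / fact j) * exp l"]) auto
    from summable_on_cmult_left[OF this, of B] show ?thesis
      by (simp add: case_prod_beta')
  qed
  have "(\<lambda>p. norm (a p)) summable_on UNIV \<times> UNIV"
  proof (rule Infinite_Sum.abs_summable_on_comparison_test'[OF dom])
    fix p :: "nat \<times> nat"
    obtain j n where p: "p = (j, n)" by (cases p)
    have "norm (a p) = (l ^ j / fact j) * (l ^ n / fact n) * \<bar>w (n + j)\<bar>"
      using l by (simp add: a_def p abs_mult power_abs)
    also have "\<dots> \<le> (l ^ j / fact j) * (l ^ n / fact n) * B"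
      by (rule mult_left_mono[OF B]) (use l in simp)
    finally show "norm (a p) \<le> (case p of (j, n) \<Rightarrow> (l ^ j / fact j) * (l ^ n / fact n) * B)"
      by (simp add: p)
  qed
  then have a_sum: "a summable_on UNIV \<times> UNIV" by (rule abs_summable_summable)
  then have tot: "(a has_sum infsum a (UNIV \<times> UNIV)) (UNIV \<times> UNIV)" by simp
  have row: "((\<lambda>n. a (j, n)) has_sum ((- l) ^ j / fact j * (\<Sum>n. l ^ n / fact n * w (n + j)))) UNIV" for j
  proof -
    have "summable (\<lambda>n. l ^ n / fact n * \<bar>w (n + j)\<bar>)"
      by (rule summable_exp_bounded[where B=B]) (use B in auto)
    then have "((\<lambda>n. l ^ n / fact n * w (n + j)) has_sum (\<Sum>n. l ^ n / fact n * w (n + j))) UNIV"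
      using l by (intro norm_summable_imp_has_sum summable_sums summable_exp_bounded[where B=B] B)
        (simp add: abs_mult)
    from has_sum_cmult_right[OF this, of "(- l) ^ j / fact j"] show ?thesis
      by (simp only: a_def prod.case)
  qed
  have "(\<lambda>j. (- l) ^ j / fact j * (\<Sum>n. l ^ n / fact n * w (n + j))) sums infsum a (UNIV \<times> UNIV)"
    by (rule has_sum_imp_sums, rule has_sum_Sigma'[OF tot]) (rule row)
  moreover have "infsum a (UNIV \<times> UNIV) = w 0"
  proof -
    \<comment> \<open>Summation along the diagonals \<open>j + n = N\<close>.\<close>
    let ?g = "\<lambda>(N, j). (j, N - j) :: nat \<times> nat"
    have bij: "bij_betw ?g (Sigma UNIV (\<lambda>N. {..N})) (UNIV \<times> UNIV)"
      by (rule bij_betwI[where g="\<lambda>(j, n). (n + j, j)"]) auto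
    have diag: "(\<Sum>j\<le>N. a (j, N - j)) = (if N = 0 then w 0 else 0)" for N
    proof -
      have "(\<Sum>j\<le>N. a (j, N - j)) = (\<Sum>j\<le>N. w N / fact N * (of_nat (N choose j) * (- l) ^ j * l ^ (N - j)))"
        by (intro sum.cong) (auto simp: a_def binomial_fact)
      also have "\<dots> = w N / fact N * (- l + l) ^ N"
        by (subst binomial_ring) (simp add: sum_distrib_left)
      finally show ?thesis by simp
    qed
    have "((\<lambda>p. a (?g p)) has_sum infsum a (UNIV \<times> UNIV)) (Sigma UNIV (\<lambda>N. {..N}))"
      using tot by (subst has_sum_reindex_bij_betw[OF bij])
    then have "((\<lambda>N. \<Sum>j\<le>N. a (j, N - j)) has_sum infsum a (UNIV \<times> UNIV)) UNIV"
      by (rule has_sum_Sigma') (auto intro!: has_sum_finiteI)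
    then have "((\<lambda>N. if N = 0 then w 0 else 0) has_sum infsum a (UNIV \<times> UNIV)) (UNIV :: nat set)"
      unfolding diag .
    moreover have "((\<lambda>N. if N = 0 then w 0 else 0) has_sum w 0) (UNIV :: nat set)"
      by (rule has_sum_cong_neutral[THEN iffD1, OF _ _ _ has_sum_finiteI[of "{0}"]]) auto
    ultimately show ?thesis by (rule has_sum_unique)
  qed
  ultimately show ?thesis by simp
qed

section \<open>Deconvolution of a compound Poisson distribution\<close>

lemma integral_shift_tendsto:
  fixes f :: "real \<Rightarrow> real"
  assumes N: "real_distribution N" and f [measurable]: "f \<in> borel_measurable borel"
    and B: "\<And>x. \<bar>f x\<bar> \<le> B" and lim: "(f \<longlongrightarrow> L) at_top"
  shows "((\<lambda>x. \<integral>v. f (x - v) \<partial>N) \<longlongrightarrow> L) at_top"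
proof -
  interpret N: real_distribution N by fact
  have "((\<lambda>x. \<integral>v. f (x - v) \<partial>N) \<longlongrightarrow> (\<integral>v. L \<partial>N)) at_top"
  proof (rule integral_dominated_convergence_at_top[where w="\<lambda>_. B"])
    have "filterlim (\<lambda>x. x - v) at_top (at_top :: real filter)" for v
      using filterlim_add_const_at_top[of "-v"] by simp
    from filterlim_compose[OF lim this]
    show "AE v in N. ((\<lambda>x. f (x - v)) \<longlongrightarrow> L) at_top" by simp
  qed (use B in auto)
  then show ?thesis using N.prob_space by simp
qed

text \<open>The value \<open>r * G\<^sup>*\<^sup>n\<close>, that is, the \<open>n\<close>-th power of the operator of convolution with \<open>G\<close>, applied to \<open>r\<close>.\<close>

definition smoothed :: "real measure \<Rightarrow> (real \<Rightarrow> real) \<Rightarrow> nat \<Rightarrow> real \<Rightarrow> real" where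
  "smoothed G r n x = (\<integral>v. r (x - v) \<partial>conv_power G n)"

lemma smoothed_const:
  assumes "real_distribution G"
  shows "smoothed G (\<lambda>_. k) n x = k"
proof -
  interpret N: real_distribution "conv_power G n" by (rule real_distribution_conv_power[OF assms])
  show ?thesis unfolding smoothed_def using N.prob_space by simp
qed

context
  fixes G :: "real measure" and r :: "real \<Rightarrow> real" and B :: real
  assumes G: "real_distribution G" and r [measurable]: "r \<in> borel_measurable borel"
    and B: "\<And>x. \<bar>r x\<bar> \<le> B"
begin

lemma smoothed_measurable [measurable]: "smoothed G r n \<in> borel_measurable borel"
proof -
  interpret N: real_distribution "conv_power G n" by (rule real_distribution_conv_power[OF G])
  show ?thesis unfolding smoothed_def by measurable
qed

lemma smoothed_bound: "\<bar>smoothed G r n x\<bar> \<le> B"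
  unfolding smoothed_def by (intro abs_integral_le real_distribution_conv_power G B) measurable

lemma smoothed_0: "smoothed G r 0 x = r x"
  unfolding smoothed_def conv_power.simps by (subst integral_return) auto

lemma smoothed_Suc: "smoothed G r (Suc n) x = (\<integral>v. smoothed G r n (x - v) \<partial>G)"
  unfolding smoothed_def conv_power.simps
  by (subst integral_convolution[OF G real_distribution_conv_power[OF G], where B=B])
     (use B in \<open>auto simp: diff_diff_eq\<close>)

lemma exp_smoothed_measurable [measurable]:
  "(\<lambda>x. \<Sum>n. l ^ n / fact n * smoothed G r (n + j) x) \<in> borel_measurable borel"
  by measurable

lemma exp_smoothed_Suc:
  assumes l: "l \<ge> 0"
  shows "(\<Sum>n. l ^ n / fact n * smoothed G r (n + Suc j) x) =
    (\<integral>v. (\<Sum>n. l ^ n / fact n * smoothed G r (n + j) (x - v)) \<partial>G)"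
proof -
  interpret G: real_distribution G by (rule G)
  have int: "integrable G (\<lambda>v. smoothed G r n (x - v))" for n
    by (rule G.integrable_const_bound[where B=B]) (auto simp: smoothed_bound)
  have "(\<integral>v. (\<Sum>n. l ^ n / fact n * smoothed G r (n + j) (x - v)) \<partial>G) =
      (\<Sum>n. \<integral>v. l ^ n / fact n * smoothed G r (n + j) (x - v) \<partial>G)"
  proof (rule integral_suminf)
    show "integrable G (\<lambda>v. l ^ n / fact n * smoothed G r (n + j) (x - v))" for n
      using int by simp
    have "summable (\<lambda>n. norm (l ^ n / fact n * smoothed G r (n + j) y))" for y
      using summable_exp_bounded[of "\<lambda>n. \<bar>smoothed G r (n + j) y\<bar>" B l] smoothed_bound l
      by (simp add: abs_mult)
    then show "AE v in G. summable (\<lambda>n. norm (l ^ n / fact n * smoothed G r (n + j) (x - v)))"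
      by simp
    have "summable (\<lambda>n. l ^ n / fact n * (\<integral>v. \<bar>smoothed G r (n + j) (x - v)\<bar> \<partial>G))"
      by (rule summable_exp_bounded[where B=B], rule abs_integral_le[OF G])
         (auto simp: smoothed_bound)
    then show "summable (\<lambda>n. \<integral>v. norm (l ^ n / fact n * smoothed G r (n + j) (x - v)) \<partial>G)"
      using l by (simp add: abs_mult)
  qed
  also have "\<dots> = (\<Sum>n. l ^ n / fact n * smoothed G r (n + Suc j) x)"
    by (simp add: smoothed_Suc)
  finally show ?thesis by simp
qed

text \<open>The series \<open>E 0\<close> is \<open>exp l\<close> times the convolution of \<open>r\<close> with the compound Poisson distribution.  Its limit
passes to all \<open>E j\<close>, the further convolutions with \<open>G\<^sup>*\<^sup>j\<close>, and \<open>r\<close> is recovered from these by the inverse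
exponential series.\<close>

lemma deconvolution_tendsto:
  assumes l: "l \<ge> 0"
    and lim: "((\<lambda>x. \<Sum>n. l ^ n / fact n * smoothed G r n x) \<longlongrightarrow> exp l * L) at_top"
  shows "(r \<longlongrightarrow> L) at_top"
proof -
  define E where "E = (\<lambda>j x. \<Sum>n. l ^ n / fact n * smoothed G r (n + j) x)"
  have E_bound: "\<bar>E j x\<bar> \<le> exp l * B" for j x
    unfolding E_def by (intro abs_exp_series_le smoothed_bound l)
  have [measurable]: "E j \<in> borel_measurable borel" for j
    unfolding E_def by measurable
  have E_lim: "(E j \<longlongrightarrow> exp l * L) at_top" for j
  proof (induction j)
    case 0
    then show ?case using lim by (simp add: E_def)
  next
    case (Suc j)
    have "E (Suc j) = (\<lambda>x. \<integral>v. E j (x - v) \<partial>G)"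
      unfolding E_def using exp_smoothed_Suc[OF l] by (simp add: fun_eq_iff)
    then show ?case
      using integral_shift_tendsto[OF G _ E_bound Suc.IH] by simp
  qed
  have "((\<lambda>x. \<Sum>j. (- l) ^ j / fact j * E j x) \<longlongrightarrow> (\<Sum>j. (- l) ^ j / fact j * (exp l * L))) at_top"
  proof (rule tannerys_theorem[THEN conjunct2, THEN conjunct2])
    show "((\<lambda>x. (- l) ^ j / fact j * E j x) \<longlongrightarrow> (- l) ^ j / fact j * (exp l * L)) at_top" for j
      by (intro tendsto_intros E_lim)
    show "eventually (\<lambda>(j, x). norm ((- l) ^ j / fact j * E j x) \<le> l ^ j / fact j * (exp l * B))
        (at_top \<times>\<^sub>F at_top)"
      using l by (intro always_eventually)
        (auto simp: abs_mult power_abs intro!: mult_left_mono divide_right_mono E_bound)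
    show "summable (\<lambda>j. l ^ j / fact j * (exp l * B))"
      by (intro summable_mult2 summable_exp_real)
  qed simp
  moreover have "(\<Sum>j. (- l) ^ j / fact j * E j x) = r x" for x
    unfolding E_def using exp_series_inversion[of "\<lambda>n. smoothed G r n x" B l] smoothed_bound l
    by (simp add: sums_iff smoothed_0)
  moreover have "(\<Sum>j. (- l) ^ j / fact j * (exp l * L)) = L"
    using sums_mult2[OF exp_real_sums[of "- l"], of "exp l * L"]
    by (simp add: sums_iff exp_minus)
  ultimately show ?thesis by simp
qed

end

section \<open>Compound Poisson distributions\<close>

context
  fixes G :: "real measure" and l :: real
  assumes G: "real_distribution G" and l: "l > 0"
begin

lemma real_distribution_compound_poisson: "real_distribution (compound_poisson l G)"
proof -
  have "emeasure (conv_power G n) UNIV = 1" for n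
    using real_distribution_conv_power[OF G, of n]
    by (metis prob_space.emeasure_space_1 real_distribution_def space_conv_power)
  then have "emeasure (compound_poisson l G) UNIV = ennreal (exp (- l)) * (\<Sum>n. ennreal (l ^ n / fact n))"
    by (simp add: emeasure_compound_poisson)
  also have "(\<Sum>n. ennreal (l ^ n / fact n)) = ennreal (exp l)"
    using l exp_real_sums[of l] by (subst suminf_ennreal2) (auto simp: sums_iff)
  finally have "emeasure (compound_poisson l G) UNIV = 1"
    by (simp add: ennreal_mult[symmetric] exp_minus)
  then have "prob_space (compound_poisson l G)"
    by (intro prob_spaceI) simp
  then show ?thesis
    by (simp add: real_distribution_def real_distribution_axioms_def)
qed

text \<open>The defining formula in real numbers.  The factor \<open>exp l\<close> stands on the right so that the series has plain
exponential weights.\<close>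

lemma compound_poisson_measure_sums:
  assumes A: "A \<in> sets borel"
  shows "(\<lambda>n. l ^ n / fact n * measure (conv_power G n) A) sums (exp l * measure (compound_poisson l G) A)"
proof -
  interpret \<mu>: real_distribution "compound_poisson l G"
    by (rule real_distribution_compound_poisson)
  have em: "emeasure (conv_power G n) A = ennreal (measure (conv_power G n) A)" for n
  proof -
    interpret N: real_distribution "conv_power G n" by (rule real_distribution_conv_power[OF G])
    show ?thesis by (rule N.emeasure_eq_measure)
  qed
  have le: "\<bar>measure (conv_power G n) A\<bar> \<le> 1" for n
  proof -
    interpret N: real_distribution "conv_power G n" by (rule real_distribution_conv_power[OF G])
    show ?thesis by simp
  qed
  let ?f = "\<lambda>n. l ^ n / fact n * measure (conv_power G n) A"
  have sm: "summable ?f" by (rule summable_exp_bounded[OF le])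
  have term_eq: "ennreal (l ^ n / fact n) * emeasure (conv_power G n) A = ennreal (?f n)" for n
    unfolding em by (rule ennreal_mult[symmetric]) (use l in auto)
  have "ennreal (measure (compound_poisson l G) A) = ennreal (exp (- l)) * (\<Sum>n. ennreal (?f n))"
    by (simp only: \<mu>.emeasure_eq_measure[symmetric] emeasure_compound_poisson[OF A] term_eq)
  also have "(\<Sum>n. ennreal (?f n)) = ennreal (suminf ?f)"
    using l by (intro suminf_ennreal2 sm) auto
  also have "ennreal (exp (- l)) * \<dots> = ennreal (exp (- l) * suminf ?f)"
    using l by (intro ennreal_mult[symmetric] suminf_nonneg sm) auto
  finally have eq: "ennreal (measure (compound_poisson l G) A) = ennreal (exp (- l) * suminf ?f)" .
  have "0 \<le> suminf ?f"
    by (rule suminf_nonneg[OF sm]) (use l in auto)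
  then have "measure (compound_poisson l G) A = exp (- l) * suminf ?f"
    using eq by (subst (asm) ennreal_inj) auto
  then have "exp l * measure (compound_poisson l G) A = suminf ?f"
    by (simp add: exp_minus)
  with sm show ?thesis by (simp add: sums_iff)
qed

lemma compound_poisson_local_sums:
  "(\<lambda>n. l ^ n / fact n * local_prob c (conv_power G n) x)
    sums (exp l * local_prob c (compound_poisson l G) x)"
  unfolding local_prob_def by (rule compound_poisson_measure_sums) simp

lemma local_prob_le_compound_poisson:
  "local_prob c G x \<le> exp l / l * local_prob c (compound_poisson l G) x"
proof -
  let ?f = "\<lambda>n. l ^ n / fact n * local_prob c (conv_power G n) x"
  have "(\<Sum>n\<in>{1}. ?f n) \<le> suminf ?f"
    using compound_poisson_local_sums[of c x] l
    by (intro sum_le_suminf) (auto simp: sums_iff local_prob_nonneg)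
  then have "l * local_prob c G x \<le> exp l * local_prob c (compound_poisson l G) x"
    using sums_unique[OF compound_poisson_local_sums[of c x]] conv_power_1[OF G] by simp
  then show ?thesis using l by (simp add: field_simps)
qed

lemma AE_nonneg_compound_poisson:
  assumes "AE v in G. 0 \<le> v"
  shows "AE v in compound_poisson l G. 0 \<le> v"
proof -
  interpret \<mu>: real_distribution "compound_poisson l G"
    by (rule real_distribution_compound_poisson)
  have "measure (conv_power G n) {..<0} = 0" for n
  proof -
    interpret N: real_distribution "conv_power G n" by (rule real_distribution_conv_power[OF G])
    have "AE v in conv_power G n. v \<notin> {..<0}"
      using AE_nonneg_conv_power[OF G assms, of n] by (auto elim!: eventually_mono)
    then show ?thesis by (intro N.prob_eq_0[THEN iffD2]) auto
  qed
  then have "exp l * measure (compound_poisson l G) {..<0} = 0"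
    using compound_poisson_measure_sums[of "{..<0}"] by (simp add: sums_iff)
  then have "AE v in compound_poisson l G. v \<notin> {..<0}"
    by (subst (asm) mult_eq_0_iff) (auto simp: \<mu>.prob_eq_0)
  then show ?thesis by (auto elim!: eventually_mono)
qed

end

section \<open>Transfer along a local ratio\<close>

context local_reference
begin

lemma S_Delta_iff_ratio:
  "F \<in> S_Delta c \<longleftrightarrow> ((\<lambda>x. local_prob c (F \<star> F) x / \<tau> x) \<longlongrightarrow> 2) at_top"
proof -
  have "F \<in> S_Delta c \<longleftrightarrow> local_prob c (F \<star> F) \<sim>[at_top] (\<lambda>x. 2 * \<tau> x)"
    using F_L conv_power_2[OF F_dist] by (simp add: S_Delta_def)
  also have "\<dots> \<longleftrightarrow> ((\<lambda>x. local_prob c (F \<star> F) x / \<tau> x / 2) \<longlongrightarrow> 1) at_top"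
    unfolding asymp_equiv_def
    by (rule tendsto_cong) (use tau_pos in eventually_elim, auto)
  also have "\<dots> \<longleftrightarrow> ((\<lambda>x. local_prob c (F \<star> F) x / \<tau> x) \<longlongrightarrow> 2) at_top"
    using tendsto_mult_right_iff[of "1/2" "\<lambda>x. local_prob c (F \<star> F) x / \<tau> x" 2 at_top]
    by simp
  finally show ?thesis .
qed

context
  fixes H :: "real measure" and k :: real
  assumes H: "real_distribution H" and k: "k > 0"
    and lim: "((\<lambda>x. local_prob c H x / \<tau> x) \<longlongrightarrow> k) at_top"
begin

lemma L_Delta_transfer: "H \<in> L_Delta c"
proof -
  have pos: "eventually (\<lambda>x. 0 < local_prob c H x) at_top"
    using order_tendstoD(1)[OF lim k] tau_pos
    by eventually_elim (simp add: zero_less_divide_iff)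
  then obtain x0 where x0: "\<And>x. x \<ge> x0 \<Longrightarrow> 0 < local_prob c H x"
    by (auto simp: eventually_at_top_linorder)
  have "(\<lambda>x. local_prob c H (x + y)) \<sim>[at_top] local_prob c H" for y
  proof (rule asymp_equivI')
    have sh: "filterlim (\<lambda>x. x + y) at_top at_top" by (rule filterlim_add_const_at_top)
    have "((\<lambda>x. local_prob c H (x + y) / \<tau> (x + y) * (\<tau> (x + y) / \<tau> x) / (local_prob c H x / \<tau> x))
        \<longlongrightarrow> k * 1 / k) at_top"
      using k by (intro tendsto_intros tau_shift lim filterlim_compose[OF lim sh]) simp
    then have "((\<lambda>x. local_prob c H (x + y) / \<tau> (x + y) * (\<tau> (x + y) / \<tau> x) / (local_prob c H x / \<tau> x))
        \<longlongrightarrow> 1) at_top" using k by simp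
    then show "((\<lambda>x. local_prob c H (x + y) / local_prob c H x) \<longlongrightarrow> 1) at_top"
    proof (rule Lim_transform_eventually)
      show "eventually (\<lambda>x. local_prob c H (x + y) / \<tau> (x + y) * (\<tau> (x + y) / \<tau> x) / (local_prob c H x / \<tau> x)
          = local_prob c H (x + y) / local_prob c H x) at_top"
        using tau_pos pos eventually_compose_filterlim[OF tau_pos sh]
        by eventually_elim (simp add: field_simps)
    qed
  qed
  then show ?thesis
    using H c_pos x0 unfolding L_Delta_def long_tailed_def
    by (auto intro!: borel_measurable_local_prob local_prob_nonneg exI[of _ "max 1 x0"])
qed

lemma D_Delta_transfer:
  assumes "F \<in> D_Delta c"
  shows "H \<in> D_Delta c"
proof -
  obtain x0 K where x0: "x0 > 0" and K: "K > 0" "\<And>x y. x > x0 \<Longrightarrow> y > 0 \<Longrightarrow> \<tau> (x + y) \<le> K * \<tau> x"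
    using assms unfolding D_Delta_def almost_decreasing_def by blast
  have "eventually (\<lambda>x. k / 2 < local_prob c H x / \<tau> x) at_top"
    using k by (intro order_tendstoD(1)[OF lim]) simp
  moreover have "eventually (\<lambda>x. local_prob c H x / \<tau> x < 2 * k) at_top"
    using k by (intro order_tendstoD(2)[OF lim]) simp
  ultimately have "eventually (\<lambda>x. k / 2 * \<tau> x \<le> local_prob c H x \<and> local_prob c H x \<le> 2 * k * \<tau> x) at_top"
    using tau_pos by eventually_elim (auto simp: field_simps)
  then obtain x1 where x1: "\<And>x. x \<ge> x1 \<Longrightarrow> k / 2 * \<tau> x \<le> local_prob c H x"
    "\<And>x. x \<ge> x1 \<Longrightarrow> local_prob c H x \<le> 2 * k * \<tau> x"
    by (auto simp: eventually_at_top_linorder)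
  have "local_prob c H (x + y) \<le> 4 * K * local_prob c H x" if "x > max x0 x1" "y > 0" for x y
  proof -
    have "local_prob c H (x + y) \<le> 2 * k * \<tau> (x + y)"
      using that by (intro x1(2)) auto
    also have "\<dots> \<le> 2 * k * (K * \<tau> x)"
      using that k by (intro mult_left_mono K(2)) auto
    also have "\<dots> = 4 * K * (k / 2 * \<tau> x)" by simp
    also have "\<dots> \<le> 4 * K * local_prob c H x"
      using that K(1) by (intro mult_left_mono x1(1)) auto
    finally show ?thesis .
  qed
  then have "max x0 x1 > 0 \<and> (\<exists>K>0. \<forall>x>max x0 x1. \<forall>y>0. local_prob c H (x + y) \<le> K * local_prob c H x)"
    using x0 K(1) by (intro conjI exI[of _ "4 * K"]) auto
  then show ?thesis
    using H local_prob_nonneg unfolding D_Delta_def almost_decreasing_def by blast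
qed

lemma S_Delta_transfer:
  assumes lim2: "((\<lambda>x. local_prob c (H \<star> H) x / \<tau> x) \<longlongrightarrow> 2 * k) at_top"
  shows "H \<in> S_Delta c"
proof -
  interpret H: local_reference c H
    by unfold_locales (use c_pos L_Delta_transfer in auto)
  have "((\<lambda>x. (local_prob c (H \<star> H) x / \<tau> x) / (local_prob c H x / \<tau> x)) \<longlongrightarrow> 2 * k / k) at_top"
    using k by (intro tendsto_intros lim2 lim) simp
  then have "((\<lambda>x. local_prob c (H \<star> H) x / local_prob c H x) \<longlongrightarrow> 2 * k / k) at_top"
    by (rule Lim_transform_eventually) (use tau_pos in eventually_elim, simp)
  then show ?thesis
    using k by (simp add: H.S_Delta_iff_ratio)
qed

end

end

section \<open>Lower bounds by long tails alone\<close>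

context local_reference
begin

text \<open>A lower bound \<open>\<rho>\<close> for the lower limit of the ratio is expressed by \<open>min (M (x + \<Delta>) / \<tau> x) \<rho> \<rightarrow> \<rho>\<close>.  In this form
Fatou's lemma becomes dominated convergence, with the constant \<open>\<rho>\<close> as the dominating function.\<close>

lemma lower_ratio_truncated:
  assumes M: "real_distribution M" and N: "real_distribution N" and \<rho>: "\<rho> \<ge> 0"
    and lim: "((\<lambda>x. min (local_prob c M x / \<tau> x) \<rho>) \<longlongrightarrow> \<rho>) at_top"
  shows "((\<lambda>x. \<integral>v. indicator {..a} v * min (local_prob c M (x - v) / \<tau> x) \<rho> \<partial>N)
      \<longlongrightarrow> \<rho> * measure N {..a}) at_top"
proof -
  interpret N: real_distribution N by fact
  note [measurable] = borel_measurable_local_prob[OF M c_pos]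
  let ?g = "\<lambda>x v. indicator {..a} v * min (local_prob c M (x - v) / \<tau> x) \<rho> :: real"
  have bd: "norm (?g x v) \<le> \<rho>" for x v
    using \<rho> by (auto simp: indicator_def local_prob_nonneg)
  have "((\<lambda>x. \<integral>v. ?g x v \<partial>N) \<longlongrightarrow> (\<integral>v. indicator {..a} v * \<rho> \<partial>N)) at_top"
  proof (rule integral_dominated_convergence_at_top[where w="\<lambda>_. \<rho>"])
    have "((\<lambda>x. min (local_prob c M (x - v) / \<tau> x) \<rho>) \<longlongrightarrow> \<rho>) at_top" for v
    proof -
      have sh: "filterlim (\<lambda>x. x - v) at_top (at_top :: real filter)"
        using filterlim_add_const_at_top[of "-v"] by simp
      have "((\<lambda>x. min (min (local_prob c M (x - v) / \<tau> (x - v)) \<rho> * (\<tau> (x - v) / \<tau> x)) \<rho>)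
          \<longlongrightarrow> min (\<rho> * 1) \<rho>) at_top"
        using tau_shift[of "- v"] by (intro tendsto_intros filterlim_compose[OF lim sh]) simp
      then have low: "((\<lambda>x. min (min (local_prob c M (x - v) / \<tau> (x - v)) \<rho> * (\<tau> (x - v) / \<tau> x)) \<rho>)
          \<longlongrightarrow> \<rho>) at_top" by simp
      show ?thesis
      proof (rule tendsto_sandwich[OF _ _ low tendsto_const[of \<rho>]])
        show "eventually (\<lambda>x. min (min (local_prob c M (x - v) / \<tau> (x - v)) \<rho> * (\<tau> (x - v) / \<tau> x)) \<rho>
            \<le> min (local_prob c M (x - v) / \<tau> x) \<rho>) at_top"
          using tau_pos eventually_compose_filterlim[OF tau_pos sh]
        proof eventually_elim
          case (elim x)
          have "min (local_prob c M (x - v) / \<tau> (x - v)) \<rho> * (\<tau> (x - v) / \<tau> x)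
              \<le> (local_prob c M (x - v) / \<tau> (x - v)) * (\<tau> (x - v) / \<tau> x)"
            using elim by (intro mult_right_mono) auto
          also have "\<dots> = local_prob c M (x - v) / \<tau> x" using elim by simp
          finally show ?case by (simp add: min.coboundedI1)
        qed
      qed simp
    qed
    then show "AE v in N. ((\<lambda>x. ?g x v) \<longlongrightarrow> indicator {..a} v * \<rho>) at_top"
      by (intro AE_I2 tendsto_intros)
    show "eventually (\<lambda>x. AE v in N. norm (?g x v) \<le> \<rho>) at_top"
      by (intro always_eventually allI AE_I2 bd)
  qed auto
  then show ?thesis by (simp add: mult.commute)
qed

text \<open>For \<open>x \<ge> 2 a\<close> the events that one summand is at most \<open>a\<close> are disjoint, and together they have at least
the mass \<open>\<rho> N {..a} + \<sigma> M {..a}\<close> relative to \<open>\<tau> x\<close> in the limit.\<close>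

lemma lower_ratio_convolution:
  assumes M: "real_distribution M" and N: "real_distribution N" and nn: "\<rho> \<ge> 0" "\<sigma> \<ge> 0"
    and limM: "((\<lambda>x. min (local_prob c M x / \<tau> x) \<rho>) \<longlongrightarrow> \<rho>) at_top"
    and limN: "((\<lambda>x. min (local_prob c N x / \<tau> x) \<sigma>) \<longlongrightarrow> \<sigma>) at_top"
  shows "((\<lambda>x. min (local_prob c (M \<star> N) x / \<tau> x) (\<rho> + \<sigma>)) \<longlongrightarrow> \<rho> + \<sigma>) at_top"
proof (rule order_tendstoI)
  fix b assume b: "b < \<rho> + \<sigma>"
  have "((\<lambda>a. \<rho> * measure N {..a} + \<sigma> * measure M {..a}) \<longlongrightarrow> \<rho> * 1 + \<sigma> * 1) at_top"
    by (intro tendsto_intros measure_atMost_tendsto M N)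
  from order_tendstoD(1)[OF this, of b] b
  obtain a where a: "b < \<rho> * measure N {..a} + \<sigma> * measure M {..a}"
    using eventually_happens[of _ at_top] by fastforce
  let ?J = "\<lambda>x. (\<integral>v. indicator {..a} v * min (local_prob c M (x - v) / \<tau> x) \<rho> \<partial>N)
      + (\<integral>v. indicator {..a} v * min (local_prob c N (x - v) / \<tau> x) \<sigma> \<partial>M)"
  have "(?J \<longlongrightarrow> \<rho> * measure N {..a} + \<sigma> * measure M {..a}) at_top"
    by (intro tendsto_intros lower_ratio_truncated M N nn limM limN)
  from order_tendstoD(1)[OF this a]
  show "eventually (\<lambda>x. b < min (local_prob c (M \<star> N) x / \<tau> x) (\<rho> + \<sigma>)) at_top"
    using tau_pos eventually_ge_at_top[of "2 * a"]
  proof eventually_elim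
    case (elim x)
    have *: "(\<integral>v. indicator {..a} v * min (local_prob c P (x - v) / \<tau> x) \<kappa> \<partial>Q)
        \<le> joint_prob c P Q UNIV {..a} x / \<tau> x"
      if P: "real_distribution P" and Q: "real_distribution Q" and \<kappa>: "\<kappa> \<ge> 0" for P Q \<kappa>
    proof -
      interpret Q: real_distribution Q by fact
      note [measurable] = borel_measurable_local_prob[OF P c_pos]
      have "(\<integral>v. indicator {..a} v * min (local_prob c P (x - v) / \<tau> x) \<kappa> \<partial>Q)
          \<le> (\<integral>v. indicator {..a} v * local_prob c P (x - v) / \<tau> x \<partial>Q)"
      proof (rule integral_mono)
        show "integrable Q (\<lambda>v. indicator {..a} v * min (local_prob c P (x - v) / \<tau> x) \<kappa>)"
          using \<kappa> elim(2) by (intro Q.integrable_const_bound[where B=\<kappa>])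
            (auto simp: indicator_def local_prob_nonneg)
        have "integrable Q (\<lambda>v. indicator {..a} v * local_prob c P (x - v))"
          by (rule Q.integrable_const_bound[where B=1])
            (auto simp: indicator_def local_prob_nonneg local_prob_le_1[OF P])
        then show "integrable Q (\<lambda>v. indicator {..a} v * local_prob c P (x - v) / \<tau> x)"
          by simp
      qed (auto simp: indicator_def)
      also have "\<dots> = joint_prob c P Q UNIV {..a} x / \<tau> x"
        using joint_prob_UNIV_integral[OF P Q, of "{..a}" c x] by simp
      finally show ?thesis .
    qed
    have "0 \<le> joint_prob c M N {a<..} {a<..} x / \<tau> x"
      using elim(2) by (simp add: joint_prob_nonneg)
    moreover have "local_prob c (M \<star> N) x / \<tau> x = joint_prob c M N UNIV {..a} x / \<tau> x
        + joint_prob c N M UNIV {..a} x / \<tau> x + joint_prob c M N {a<..} {a<..} x / \<tau> x"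
      using local_prob_convolution_split[OF M N elim(3)] by (simp add: add_divide_distrib)
    ultimately have "b < local_prob c (M \<star> N) x / \<tau> x"
      using elim(1) *[OF M N nn(1)] *[OF N M nn(2)] by linarith
    with b show ?case by simp
  qed
next
  fix b assume "\<rho> + \<sigma> < b"
  then show "eventually (\<lambda>x. min (local_prob c (M \<star> N) x / \<tau> x) (\<rho> + \<sigma>) < b) at_top"
    by (intro always_eventually allI) (simp add: min.strict_coboundedI2)
qed

lemma lower_ratio_conv_power:
  "((\<lambda>x. min (local_prob c (conv_power F n) x / \<tau> x) (real n)) \<longlongrightarrow> real n) at_top"
proof (induction n)
  case 0
  have "eventually (\<lambda>x. min (local_prob c (conv_power F 0) x / \<tau> x) (real 0) = real 0) at_top"
    using tau_pos by eventually_elim (simp add: local_prob_nonneg)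
  then show ?case by (rule tendsto_eventually)
next
  case (Suc n)
  have "eventually (\<lambda>x. min (\<tau> x / \<tau> x) 1 = 1) at_top"
    using tau_pos by eventually_elim simp
  then have "((\<lambda>x. min (\<tau> x / \<tau> x) 1) \<longlongrightarrow> 1) at_top"
    by (rule tendsto_eventually)
  from lower_ratio_convolution[OF F_dist real_distribution_conv_power[OF F_dist] _ _ this Suc.IH]
  show ?case by simp
qed

text \<open>With \<open>R n\<close> the ratio of \<open>F\<^sup>*\<^sup>n\<close> and \<open>m n = min (R n) n\<close>, the weighted sums of \<open>R n\<close> and of \<open>m n\<close> have the same limit.
The differences \<open>R n - m n\<close> are non-negative, so each of them tends to 0; \<open>n = 2\<close> is the claim.\<close>

lemma S_Delta_of_compound_poisson_ratio:
  assumes l: "l > 0"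
    and lim: "((\<lambda>x. local_prob c (compound_poisson l F) x / \<tau> x) \<longlongrightarrow> l) at_top"
  shows "F \<in> S_Delta c"
proof -
  define R where "R = (\<lambda>n x. local_prob c (conv_power F n) x / \<tau> x)"
  define m where "m = (\<lambda>n x. min (R n x) (real n))"
  have R_sums: "(\<lambda>n. l ^ n / fact n * R n x) sums (exp l * (local_prob c (compound_poisson l F) x / \<tau> x))" for x
    using sums_divide[OF compound_poisson_local_sums[OF F_dist l, of c x], of "\<tau> x"]
    by (simp add: R_def)
  have n_sums: "(\<lambda>n. l ^ n / fact n * real n) sums (l * exp l)"
    using exp_series_shift[of "\<lambda>_. 1" 1 l] exp_real_sums[of l] by (simp add: sums_iff)
  have R_nonneg: "0 \<le> R n x" for n x
    by (simp add: R_def local_prob_nonneg)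
  have m_lim: "(m n \<longlongrightarrow> real n) at_top" for n
    unfolding m_def R_def by (rule lower_ratio_conv_power)
  have m_sum: "summable (\<lambda>n. l ^ n / fact n * m n x)" for x
  proof (rule summable_comparison_test'[OF sums_summable[OF n_sums], where N=0])
    show "norm (l ^ n / fact n * m n x) \<le> l ^ n / fact n * real n" for n
      using l R_nonneg[of n x] by (auto simp: m_def abs_mult intro!: mult_left_mono divide_right_mono)
  qed
  have "((\<lambda>x. \<Sum>n. l ^ n / fact n * m n x) \<longlongrightarrow> (\<Sum>n. l ^ n / fact n * real n)) at_top"
  proof (rule tannerys_theorem[THEN conjunct2, THEN conjunct2])
    show "((\<lambda>x. l ^ n / fact n * m n x) \<longlongrightarrow> l ^ n / fact n * real n) at_top" for n
      by (intro tendsto_intros m_lim)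
    show "eventually (\<lambda>(n, x). norm (l ^ n / fact n * m n x) \<le> l ^ n / fact n * real n) (at_top \<times>\<^sub>F at_top)"
      using l R_nonneg by (intro always_eventually)
        (auto simp: m_def abs_mult intro!: mult_left_mono divide_right_mono)
  qed (use sums_summable[OF n_sums] in auto)
  then have "((\<lambda>x. \<Sum>n. l ^ n / fact n * m n x) \<longlongrightarrow> exp l * l) at_top"
    using n_sums by (simp add: sums_iff mult.commute)
  moreover have "((\<lambda>x. exp l * (local_prob c (compound_poisson l F) x / \<tau> x)) \<longlongrightarrow> exp l * l) at_top"
    by (intro tendsto_intros lim)
  ultimately have "((\<lambda>x. exp l * (local_prob c (compound_poisson l F) x / \<tau> x)
      - (\<Sum>n. l ^ n / fact n * m n x)) \<longlongrightarrow> exp l * l - exp l * l) at_top"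
    by (intro tendsto_diff)
  then have gap: "((\<lambda>x. exp l * (local_prob c (compound_poisson l F) x / \<tau> x)
      - (\<Sum>n. l ^ n / fact n * m n x)) \<longlongrightarrow> 0) at_top" by simp
  have gap2: "((\<lambda>x. l ^ 2 / fact 2 * (R 2 x - m 2 x)) \<longlongrightarrow> 0) at_top"
  proof (rule tendsto_sandwich[OF _ _ tendsto_const gap])
    show "eventually (\<lambda>x. 0 \<le> l ^ 2 / fact 2 * (R 2 x - m 2 x)) at_top"
      by (intro always_eventually) (simp add: m_def)
    have "l ^ 2 / fact 2 * (R 2 x - m 2 x) \<le> exp l * (local_prob c (compound_poisson l F) x / \<tau> x)
      - (\<Sum>n. l ^ n / fact n * m n x)" for x
    proof -
      let ?d = "\<lambda>n. l ^ n / fact n * R n x - l ^ n / fact n * m n x"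
      have d: "?d sums (exp l * (local_prob c (compound_poisson l F) x / \<tau> x) - (\<Sum>n. l ^ n / fact n * m n x))"
        by (intro sums_diff R_sums summable_sums m_sum)
      have "(\<Sum>n\<in>{2}. ?d n) \<le> suminf ?d"
        using l by (intro sum_le_suminf sums_summable[OF d])
          (auto simp: m_def intro!: mult_left_mono divide_right_mono)
      then show ?thesis using sums_unique[OF d] by (simp add: right_diff_distrib)
    qed
    then show "eventually (\<lambda>x. l ^ 2 / fact 2 * (R 2 x - m 2 x) \<le>
        exp l * (local_prob c (compound_poisson l F) x / \<tau> x) - (\<Sum>n. l ^ n / fact n * m n x)) at_top"
      by (intro always_eventually allI)
  qed
  have "((\<lambda>x. fact 2 / l ^ 2 * (l ^ 2 / fact 2 * (R 2 x - m 2 x)) + m 2 x) \<longlongrightarrow> fact 2 / l ^ 2 * 0 + real 2) at_top"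
    by (intro tendsto_intros gap2 m_lim)
  then have "(R 2 \<longlongrightarrow> 2) at_top"
    using l by (simp add: diff_divide_distrib)
  then show ?thesis
    unfolding S_Delta_iff_ratio R_def using conv_power_2[OF F_dist] by simp
qed

end

section \<open>Local ratios of compound Poisson distributions\<close>

context subexponential_reference
begin

lemma local_asymp_return: "local_asymp (return borel 0) (\<lambda>_. 0)"
proof -
  have "eventually (\<lambda>x. local_prob c (return borel 0) x / \<tau> x - 0 = 0) at_top"
    using eventually_ge_at_top[of 0]
    by eventually_elim (simp add: local_prob_def measure_return indicator_def)
  moreover have "admissible (return borel 0)"
    unfolding admissible_def using real_distribution_return by (auto simp: AE_return)
  ultimately show ?thesis
    by (auto simp: local_asymp_def intro: tendsto_eventually)
qed

lemma local_asymp_conv_power: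
  assumes M: "local_asymp M r"
  shows "local_asymp (conv_power M n) (\<lambda>x. real n * smoothed M r (n - 1) x)"
proof (induction n)
  case 0
  then show ?case using local_asymp_return by simp
next
  case (Suc n)
  have M': "real_distribution M" using M by (simp add: local_asymp_def admissible_def)
  interpret M: real_distribution M by (rule M')
  obtain B where r: "r \<in> borel_measurable borel" "\<And>x. \<bar>r x\<bar> \<le> B"
    using M by (auto simp: local_asymp_def)
  have "(\<integral>v. r (x - v) \<partial>conv_power M n) + (\<integral>v. real n * smoothed M r (n - 1) (x - v) \<partial>M)
      = real (Suc n) * smoothed M r (Suc n - 1) x" for x
  proof (cases n)
    case (Suc m)
    have "(\<integral>v. real n * smoothed M r (n - 1) (x - v) \<partial>M) = real n * smoothed M r n x"
      using smoothed_Suc[OF M' r, of m x] by (simp add: Suc)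
    moreover have "(\<integral>v. r (x - v) \<partial>conv_power M n) = smoothed M r n x"
      by (simp add: smoothed_def)
    ultimately show ?thesis by (simp add: algebra_simps)
  qed (simp add: smoothed_def)
  with local_asymp_convolution[OF M Suc.IH] show ?case by simp
qed

text \<open>Summation of the local ratios of the convolution powers.  The subtracted series is \<open>exp l\<close> times the
convolution of \<open>r\<close> with the compound Poisson distribution, because \<open>n l\<^sup>n / n! = l l\<^sup>n\<^sup>-\<^sup>1 / (n - 1)!\<close>.\<close>

lemma compound_poisson_ratio_smoothed:
  assumes M: "local_asymp M r" and l: "l > 0"
  shows "((\<lambda>x. exp l * (local_prob c (compound_poisson l M) x / \<tau> x)
      - l * (\<Sum>n. l ^ n / fact n * smoothed M r n x)) \<longlongrightarrow> 0) at_top"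
proof -
  have M': "real_distribution M" using M by (simp add: local_asymp_def admissible_def)
  obtain B where r: "r \<in> borel_measurable borel" "\<And>x. \<bar>r x\<bar> \<le> B"
    using M by (auto simp: local_asymp_def)
  define R where "R = (\<lambda>n x. local_prob c (conv_power M n) x / \<tau> x)"
  define p where "p = (\<lambda>n x. real n * smoothed M r (n - 1) x)"
  have R_sums: "(\<lambda>n. l ^ n / fact n * R n x) sums (exp l * (local_prob c (compound_poisson l M) x / \<tau> x))" for x
    using sums_divide[OF compound_poisson_local_sums[OF M' l, of c x], of "\<tau> x"]
    by (simp add: R_def)
  have p_sums: "(\<lambda>n. l ^ n / fact n * p n x) sums (l * (\<Sum>n. l ^ n / fact n * smoothed M r n x))" for x
    unfolding p_def by (rule exp_series_shift[where B=B]) (rule smoothed_bound[OF M' r])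
  have p_bound: "\<bar>p n x\<bar> \<le> real n * B" for n x
    unfolding p_def by (simp add: abs_mult smoothed_bound[OF M' r] mult_left_mono)
  obtain K x0 where K: "K > 0" and x0: "\<And>n x. x \<ge> x0 \<Longrightarrow> local_prob c (conv_power M n) x \<le> K ^ n * \<tau> x"
    using conv_power_bound[OF M] by blast
  have "((\<lambda>x. \<Sum>n. l ^ n / fact n * (R n x - p n x)) \<longlongrightarrow> (\<Sum>n. 0)) at_top"
  proof (rule tannerys_theorem[THEN conjunct2, THEN conjunct2])
    show "((\<lambda>x. l ^ n / fact n * (R n x - p n x)) \<longlongrightarrow> 0) at_top" for n
      using local_asymp_conv_power[OF M, of n]
      by (intro tendsto_mult_right_zero) (simp add: R_def p_def local_asymp_def)
    have "eventually (\<lambda>x. \<forall>n. norm (l ^ n / fact n * (R n x - p n x)) \<le> (l * K) ^ n / fact n + l ^ n / fact n * (real n * B)) at_top"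
      using eventually_ge_at_top[of x0] tau_pos
    proof eventually_elim
      case (elim x)
      show ?case
      proof
        fix n
        have "0 \<le> R n x" "R n x \<le> K ^ n"
          using x0[OF elim(1), of n] elim(2) by (auto simp: R_def local_prob_nonneg field_simps)
        then have "\<bar>R n x - p n x\<bar> \<le> K ^ n + real n * B"
          using p_bound[of n x] by linarith
        then have "l ^ n / fact n * \<bar>R n x - p n x\<bar> \<le> l ^ n / fact n * (K ^ n + real n * B)"
          using l by (intro mult_left_mono) auto
        then show "norm (l ^ n / fact n * (R n x - p n x)) \<le> (l * K) ^ n / fact n + l ^ n / fact n * (real n * B)"
          using l by (simp add: abs_mult distrib_left power_mult_distrib)
      qed
    qed
    then show "eventually (\<lambda>(n, x). norm (l ^ n / fact n * (R n x - p n x))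
        \<le> (l * K) ^ n / fact n + l ^ n / fact n * (real n * B)) (at_top \<times>\<^sub>F at_top)"
      unfolding eventually_prod_filter
      by (intro exI[of _ "\<lambda>_. True"] exI conjI) (simp, assumption, simp)
    show "summable (\<lambda>n. (l * K) ^ n / fact n + l ^ n / fact n * (real n * B))"
      using exp_series_shift[of "\<lambda>_. B" "\<bar>B\<bar>" l]
      by (intro summable_add summable_exp_real) (auto simp: sums_iff)
  qed simp
  moreover have "(\<Sum>n. l ^ n / fact n * (R n x - p n x)) =
      exp l * (local_prob c (compound_poisson l M) x / \<tau> x) - l * (\<Sum>n. l ^ n / fact n * smoothed M r n x)" for x
    using sums_diff[OF R_sums p_sums, of x] by (simp add: sums_iff right_diff_distrib)
  ultimately show ?thesis by simp
qed

lemma compound_poisson_ratio: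
  assumes l: "l > 0"
  shows "((\<lambda>x. local_prob c (compound_poisson l F) x / \<tau> x) \<longlongrightarrow> l) at_top"
proof -
  have "(\<Sum>n. l ^ n / fact n * smoothed F (\<lambda>_. 1) n x) = exp l" for x
    using exp_real_sums[of l] by (simp add: smoothed_const[OF F_dist] sums_iff)
  then have "((\<lambda>x. exp l * (local_prob c (compound_poisson l F) x / \<tau> x) - l * exp l) \<longlongrightarrow> 0) at_top"
    using compound_poisson_ratio_smoothed[OF local_asymp_self l] by simp
  then have "((\<lambda>x. (exp l * (local_prob c (compound_poisson l F) x / \<tau> x) - l * exp l) / exp l + l)
      \<longlongrightarrow> 0 / exp l + l) at_top"
    by (intro tendsto_intros) auto
  then show ?thesis by (simp add: diff_divide_distrib)
qed

lemma self_convolution_transfer: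
  assumes H: "admissible H" and lim: "((\<lambda>x. local_prob c H x / \<tau> x) \<longlongrightarrow> k) at_top"
  shows "((\<lambda>x. local_prob c (H \<star> H) x / \<tau> x) \<longlongrightarrow> 2 * k) at_top"
proof -
  interpret H: real_distribution H by (rule admissible_dist[OF H])
  have "local_asymp H (\<lambda>_. k)"
    using H tendsto_diff[OF lim tendsto_const[of k]] by (auto simp: local_asymp_def)
  from local_asymp_convolution[OF this this]
  have "((\<lambda>x. local_prob c (H \<star> H) x / \<tau> x - 2 * k) \<longlongrightarrow> 0) at_top"
    using H.prob_space by (simp add: local_asymp_def)
  from tendsto_add[OF this tendsto_const[of "2 * k"]] show ?thesis by simp
qed

text \<open>Here the compound Poisson distribution itself is the reference, and the local ratio of \<open>G\<close> is
unknown but bounded.  Comparing the two expressions for the ratio of \<open>F\<close> to itself determines the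
exponential series of \<open>r\<close>, and deconvolution determines \<open>r\<close>.\<close>

lemma jump_distribution_ratio:
  assumes l: "l > 0" and G: "admissible G" and F_eq: "F = compound_poisson l G"
  shows "((\<lambda>x. local_prob c G x / \<tau> x) \<longlongrightarrow> 1 / l) at_top"
proof -
  define r where "r = (\<lambda>x. local_prob c G x / \<tau> x)"
  have G': "real_distribution G" by (rule admissible_dist[OF G])
  note [measurable] = borel_measurable_local_prob[OF G' c_pos]
  have r_meas: "r \<in> borel_measurable borel" unfolding r_def by measurable
  have r_bound: "\<bar>r x\<bar> \<le> exp l / l" for x
  proof (cases "\<tau> x = 0")
    case False
    then have "\<tau> x > 0" using local_prob_nonneg[of c F x] by linarith
    then show ?thesis
      using local_prob_le_compound_poisson[OF G' l, of c x] F_eq local_prob_nonneg[of c G x]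
      by (simp add: r_def pos_divide_le_eq)
  qed (use l in \<open>simp add: r_def\<close>)
  have "local_asymp G r"
    unfolding local_asymp_def using G r_meas r_bound by (auto simp: r_def)
  from compound_poisson_ratio_smoothed[OF this l]
  have "((\<lambda>x. exp l * (\<tau> x / \<tau> x) - l * (\<Sum>n. l ^ n / fact n * smoothed G r n x)) \<longlongrightarrow> 0) at_top"
    by (simp add: F_eq[symmetric])
  moreover have "((\<lambda>x. \<tau> x / \<tau> x) \<longlongrightarrow> 1) at_top"
    by (rule tendsto_eventually) (use tau_pos in eventually_elim, simp)
  ultimately have "((\<lambda>x. (exp l * (\<tau> x / \<tau> x) - (exp l * (\<tau> x / \<tau> x)
      - l * (\<Sum>n. l ^ n / fact n * smoothed G r n x))) / l) \<longlongrightarrow> (exp l * 1 - 0) / l) at_top"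
    using l by (intro tendsto_intros) auto
  then have "((\<lambda>x. \<Sum>n. l ^ n / fact n * smoothed G r n x) \<longlongrightarrow> exp l * (1 / l)) at_top"
    using l by simp
  from deconvolution_tendsto[OF G' r_meas r_bound _ this] l show ?thesis
    by (simp add: r_def)
qed

end

section \<open>Equivalence of the three conditions\<close>

context
  fixes c l :: real and G \<mu> :: "real measure"
  assumes c: "c > 0" and l: "l > 0" and G: "real_distribution G" and \<mu>: "\<mu> = compound_poisson l G"
begin

lemma mu_dist: "real_distribution \<mu>"
  unfolding \<mu> by (rule real_distribution_compound_poisson[OF G l])

text \<open>The jump distribution \<open>G\<close> serves as the reference, and \<open>\<mu>\<close> has the constant local ratio \<open>l\<close>.\<close>

lemma compound_poisson_inherits:
  assumes S: "G \<in> S_Delta c" and cond: "G \<in> D_Delta c \<or> (AE v in G. 0 \<le> v)"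
  shows "((\<lambda>x. local_prob c \<mu> x / local_prob c G x) \<longlongrightarrow> l) at_top"
    and "\<mu> \<in> S_Delta c" and "G \<in> D_Delta c \<Longrightarrow> \<mu> \<in> D_Delta c"
proof -
  interpret G: local_reference c G
    by unfold_locales (use c S in \<open>auto simp: S_Delta_def\<close>)
  interpret G: subexponential_reference c G
    by unfold_locales (use S cond G in \<open>auto simp: G.admissible_def\<close>)
  have adm: "G.admissible \<mu>"
    using cond mu_dist AE_nonneg_compound_poisson[OF G l] by (auto simp: G.admissible_def \<mu>)
  show lim: "((\<lambda>x. local_prob c \<mu> x / local_prob c G x) \<longlongrightarrow> l) at_top"
    unfolding \<mu> by (rule G.compound_poisson_ratio[OF l])
  show "\<mu> \<in> S_Delta c"
    by (rule G.S_Delta_transfer[OF mu_dist l lim G.self_convolution_transfer[OF adm lim]])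
  show "\<mu> \<in> D_Delta c" if "G \<in> D_Delta c"
    by (rule G.D_Delta_transfer[OF mu_dist l lim that])
qed

text \<open>The converse direction: \<open>\<mu>\<close> serves as the reference, and \<open>G\<close> has the constant local ratio \<open>1 / l\<close>.\<close>

lemma jump_distribution_closure:
  assumes S: "\<mu> \<in> S_Delta c" and cond: "\<mu> \<in> D_Delta c \<or> (AE v in G. 0 \<le> v)"
  shows "G \<in> S_Delta c" and "\<mu> \<in> D_Delta c \<Longrightarrow> G \<in> D_Delta c"
proof -
  interpret \<mu>: local_reference c \<mu>
    by unfold_locales (use c S in \<open>auto simp: S_Delta_def\<close>)
  have "\<mu>.admissible \<mu>"
    using cond mu_dist AE_nonneg_compound_poisson[OF G l, folded \<mu>]
    unfolding \<mu>.admissible_def by blast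
  then interpret \<mu>: subexponential_reference c \<mu>
    by unfold_locales (use S in auto)
  have adm: "\<mu>.admissible G"
    using cond G by (auto simp: \<mu>.admissible_def)
  have lim: "((\<lambda>x. local_prob c G x / local_prob c \<mu> x) \<longlongrightarrow> 1 / l) at_top"
    by (rule \<mu>.jump_distribution_ratio[OF l adm \<mu>])
  have "1 / l > 0" using l by simp
  note transfer = \<mu>.S_Delta_transfer[OF G this lim] \<mu>.D_Delta_transfer[OF G this lim]
  show "G \<in> S_Delta c"
    by (rule transfer(1)[OF \<mu>.self_convolution_transfer[OF adm lim]])
  show "G \<in> D_Delta c" if "\<mu> \<in> D_Delta c"
    by (rule transfer(2)[OF that])
qed

lemma S_Delta_of_ratio:
  assumes L: "G \<in> L_Delta c" and lim: "((\<lambda>x. local_prob c \<mu> x / local_prob c G x) \<longlongrightarrow> l) at_top"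
  shows "G \<in> S_Delta c"
proof -
  interpret G: local_reference c G by unfold_locales (use c L in auto)
  show ?thesis
    using lim unfolding \<mu> by (rule G.S_Delta_of_compound_poisson_ratio[OF l])
qed

end

theorem theorem4p1:
  fixes c l :: real and G \<mu> :: "real measure"
  assumes "c > 0" and "l > 0" and "real_distribution G"
    and "\<mu> = compound_poisson l G"
  shows "((\<mu> \<in> S_Delta c \<inter> D_Delta c) \<longleftrightarrow> (G \<in> S_Delta c \<inter> D_Delta c)) \<and>
         ((G \<in> S_Delta c \<inter> D_Delta c) \<longleftrightarrow>
            (G \<in> L_Delta c \<inter> D_Delta c \<and>
             ((\<lambda>x. local_prob c \<mu> x / local_prob c G x) \<longlongrightarrow> l) at_top)) \<and>
         (measure G {0..} = 1 \<longrightarrow>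
           ((\<mu> \<in> S_Delta c) \<longleftrightarrow> (G \<in> S_Delta c)) \<and>
           ((G \<in> S_Delta c) \<longleftrightarrow>
              (G \<in> L_Delta c \<and>
               ((\<lambda>x. local_prob c \<mu> x / local_prob c G x) \<longlongrightarrow> l) at_top)))"
proof -
  have SL: "G \<in> S_Delta c \<Longrightarrow> G \<in> L_Delta c" by (simp add: S_Delta_def)
  note closure = compound_poisson_inherits[OF assms]
    and root = jump_distribution_closure[OF assms]
    and ratio = S_Delta_of_ratio[OF assms]
  show ?thesis
    using closure root ratio SL half_line_AE[OF assms(3)] by blast
qed

end
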